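(* Let $\&$ be a continuous t-norm. Then the $[0,1]$-enriched category $(\mathbb{E}^1,S)$ is Smyth complete if and only if $\&$ is not isomorphic to the {\L}ukasiewicz t-norm on $[0,1]$.
   Context: A t-norm is a commutative, associative operation $\&:[0,1]\times[0,1]\to[0,1]$, monotone in each variable, with $x\,\&\,1=x$. Its residuated implication is $x\rightarrow y=\sup\{w\in[0,1] : x\,\&\,w\le y\}$. The {\L}ukasiewicz t-norm is $(a,b)\mapsto\max(a+b-1,0)$; $\&$ is isomorphic to it if there is a strictly increasing bijection $\varphi:[0,1]\to[0,1]$ with $\varphi(a\,\&\,b)=\max(\varphi(a)+\varphi(b)-1,0)$ for all $a,b\in[0,1]$. Fuzzy numbers: $\mathbb{E}^1$ is the set of all $u:\mathbb{R}\to[0,1]$ such that (1) $u(x_0)=1$ for some $x_0$; (2) $u(\lambda x+(1-\lambda)y)\ge\min\{u(x),u(y)\}$ for all $x,y\in\mathbb{R}$, $\lambda\in[0,1]$; (3) $u$ is upper semicontinuous; (4) $[u]_0=\overline{\{x: u(x)>0\}}$ is compact. Write $[u]_0=[u_0^-,u_0^+]$ and $[u]_1=\{x:u(x)=1\}=[u_1^-,u_1^+]$. The left part $u^\ell$ and right part $u^r$ are functions $\mathbb{R}\to[0,1]$: $u^\ell(x)=0$ for $x<u_0^-$, $u^\ell(x)=u(x)$ for $x\in[u_0^-,u_1^-]$, $u^\ell(x)=1$ for $x>u_1^-$; and $u^r(x)=1$ for $x<u_1^-$, $u^r(x)=u(x)$ for $x\in[u_1^-,u_0^+]$, $u^r(x)=0$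 for $x>u_0^+$. Fuzzy order and its symmetrization: for $u,v\in\mathbb{E}^1$, $P(u,v)=\inf_{x\in\mathbb{R}}\left[(v^\ell(x)\rightarrow u^\ell(x))\wedge(u^r(x)\rightarrow v^r(x))\right]$ and $S(u,v)=P(u,v)\wedge P(v,u)$. A $[0,1]$-enriched category is a set $X$ with a map $X(\cdot,\cdot):X\times X\to[0,1]$ such that $X(x,x)=1$ and $X(y,z)\,\&\,X(x,y)\le X(x,z)$. The pair $(\mathbb{E}^1,S)$ is such a category. A net $\{x_i\}_{i\in D}$ in $X$ is forward Cauchy if $\sup_{i\in D}\inf_{k\ge j\ge i}X(x_j,x_k)=1$. An element $a\in X$ is a bilimit of $\{x_i\}_{i\in D}$ if for all $x\in X$: $\sup_{i\in D}\inf_{j\ge i}X(x,x_j)=X(x,a)$ and $\sup_{i\in D}\inf_{j\ge i}X(x_j,x)=X(a,x)$. $X$ is Smyth complete if every forward Cauchy net in $X$ has a bilimit (which is then unique up to isomorphism, where $x,y$ are isomorphic if $X(x,y)=1=X(y,x)$, and is the limit of the net in the open ball topology of the symmetrization, i.e. the topology with base the sets $\{y : \min\{X(x,y),X(y,x)\}>r\}$, $x\in X$, $r<1$). *)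

theory Defs
  imports "HOL-Analysis.Analysis"
begin

section \<open>Triangular norms\<close>

text \<open>The unit interval is represented by the set \<open>{0..1}\<close> of reals; operations on it are
  functions on the reals of which only the values on \<open>{0..1}\<close> matter.\<close>

definition t_norm :: "(real \<Rightarrow> real \<Rightarrow> real) \<Rightarrow> bool" where
  "t_norm T \<longleftrightarrow>
     (\<forall>a\<in>{0..1}. \<forall>b\<in>{0..1}. T a b \<in> {0..1}) \<and>
     (\<forall>a\<in>{0..1}. \<forall>b\<in>{0..1}. T a b = T b a) \<and>
     (\<forall>a\<in>{0..1}. \<forall>b\<in>{0..1}. \<forall>c\<in>{0..1}. T (T a b) c = T a (T b c)) \<and>
     (\<forall>b\<in>{0..1}. mono_on {0..1} (\<lambda>a. T a b)) \<and>
     (\<forall>a\<in>{0..1}. mono_on {0..1} (T a)) \<and>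
     (\<forall>a\<in>{0..1}. T a 1 = a)"

definition continuous_t_norm :: "(real \<Rightarrow> real \<Rightarrow> real) \<Rightarrow> bool" where
  "continuous_t_norm T \<longleftrightarrow>
     t_norm T \<and> continuous_on ({0..1} \<times> {0..1}) (\<lambda>(a, b). T a b)"

definition residuum :: "(real \<Rightarrow> real \<Rightarrow> real) \<Rightarrow> real \<Rightarrow> real \<Rightarrow> real" where
  "residuum T a b = Sup {w \<in> {0..1}. T a w \<le> b}"

definition lukasiewicz :: "real \<Rightarrow> real \<Rightarrow> real" where
  "lukasiewicz a b = max (a + b - 1) 0"

definition isomorphic_t_norms ::
  "(real \<Rightarrow> real \<Rightarrow> real) \<Rightarrow> (real \<Rightarrow> real \<Rightarrow> real) \<Rightarrow> bool" where
  "isomorphic_t_norms T T' \<longleftrightarrow>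
     (\<exists>\<phi>. strict_mono_on {0..1} \<phi> \<and> bij_betw \<phi> {0..1} {0..1} \<and>
          (\<forall>a\<in>{0..1}. \<forall>b\<in>{0..1}. \<phi> (T a b) = T' (\<phi> a) (\<phi> b)))"


section \<open>Fuzzy numbers\<close>

definition upper_semicontinuous :: "(real \<Rightarrow> real) \<Rightarrow> bool" where
  "upper_semicontinuous u \<longleftrightarrow> (\<forall>c. open {x. u x < c})"

definition support0 :: "(real \<Rightarrow> real) \<Rightarrow> real set" where
  "support0 u = closure {x. u x > 0}"

definition core1 :: "(real \<Rightarrow> real) \<Rightarrow> real set" where
  "core1 u = {x. u x = 1}"

definition fuzzy_numbers :: "(real \<Rightarrow> real) set" where
  "fuzzy_numbers = {u.
     (\<forall>x. u x \<in> {0..1}) \<and>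
     (\<exists>x. u x = 1) \<and>
     (\<forall>x y. \<forall>t\<in>{0..1}. u (t * x + (1 - t) * y) \<ge> min (u x) (u y)) \<and>
     upper_semicontinuous u \<and>
     compact (support0 u)}"

text \<open>For a fuzzy number, \<open>support0 u\<close> and \<open>core1 u\<close> are nonempty compact intervals, so their
  endpoints are their infima and suprema.\<close>

definition left_part :: "(real \<Rightarrow> real) \<Rightarrow> real \<Rightarrow> real" where
  "left_part u x =
     (if x < Inf (support0 u) then 0
      else if x \<le> Inf (core1 u) then u x
      else 1)"

definition right_part :: "(real \<Rightarrow> real) \<Rightarrow> real \<Rightarrow> real" where
  "right_part u x =
     (if x < Inf (core1 u) then 1
      else if x \<le> Sup (support0 u) then u x
      else 0)"

definition fuzzy_order ::
  "(real \<Rightarrow> real \<Rightarrow> real) \<Rightarrow> (real \<Rightarrow> real) \<Rightarrow> (real \<Rightarrow> real) \<Rightarrow> real" where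
  "fuzzy_order T u v =
     (INF x. min (residuum T (left_part v x) (left_part u x))
                 (residuum T (right_part u x) (right_part v x)))"

definition sym_order ::
  "(real \<Rightarrow> real \<Rightarrow> real) \<Rightarrow> (real \<Rightarrow> real) \<Rightarrow> (real \<Rightarrow> real) \<Rightarrow> real" where
  "sym_order T u v = min (fuzzy_order T u v) (fuzzy_order T v u)"


section \<open>Enriched categories and Smyth completeness\<close>

definition enriched_category ::
  "(real \<Rightarrow> real \<Rightarrow> real) \<Rightarrow> 'a set \<Rightarrow> ('a \<Rightarrow> 'a \<Rightarrow> real) \<Rightarrow> bool" where
  "enriched_category T X h \<longleftrightarrow>
     (\<forall>x\<in>X. \<forall>y\<in>X. h x y \<in> {0..1}) \<and>
     (\<forall>x\<in>X. h x x = 1) \<and>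
     (\<forall>x\<in>X. \<forall>y\<in>X. \<forall>z\<in>X. T (h y z) (h x y) \<le> h x z)"

text \<open>A directed set is a set \<open>D\<close> with a preorder \<open>r\<close>, where \<open>(i, j) \<in> r\<close> stands for \<open>i \<le> j\<close>.\<close>

definition directed_set :: "'i set \<Rightarrow> 'i rel \<Rightarrow> bool" where
  "directed_set D r \<longleftrightarrow>
     D \<noteq> {} \<and> preorder_on D r \<and> (\<forall>i\<in>D. \<forall>j\<in>D. \<exists>k\<in>D. (i, k) \<in> r \<and> (j, k) \<in> r)"

definition forward_cauchy ::
  "('a \<Rightarrow> 'a \<Rightarrow> real) \<Rightarrow> 'i set \<Rightarrow> 'i rel \<Rightarrow> ('i \<Rightarrow> 'a) \<Rightarrow> bool" where
  "forward_cauchy h D r s \<longleftrightarrow>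
     (SUP i\<in>D. INF (j, k)\<in>{(j, k). (i, j) \<in> r \<and> (j, k) \<in> r}. h (s j) (s k)) = 1"

definition bilimit ::
  "'a set \<Rightarrow> ('a \<Rightarrow> 'a \<Rightarrow> real) \<Rightarrow> 'i set \<Rightarrow> 'i rel \<Rightarrow> ('i \<Rightarrow> 'a) \<Rightarrow> 'a \<Rightarrow> bool" where
  "bilimit X h D r s a \<longleftrightarrow>
     a \<in> X \<and>
     (\<forall>x\<in>X. (SUP i\<in>D. INF j\<in>{j. (i, j) \<in> r}. h x (s j)) = h x a \<and>
             (SUP i\<in>D. INF j\<in>{j. (i, j) \<in> r}. h (s j) x) = h a x)"

text \<open>HOL cannot quantify over all types inside a formula, so the type \<open>'i\<close> from which the
  index sets of the nets are drawn is a parameter. Index sets are arbitrary subsets of \<open>'i\<close>;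
  quantification over all directed sets is recovered by letting \<open>'i\<close> range over all types.
  A finite \<open>'i\<close> is degenerate, as a finite directed set has a greatest element.\<close>

definition smyth_complete :: "'i itself \<Rightarrow> 'a set \<Rightarrow> ('a \<Rightarrow> 'a \<Rightarrow> real) \<Rightarrow> bool" where
  "smyth_complete (_ :: 'i itself) X h \<longleftrightarrow>
     (\<forall>(D :: 'i set) r s.
        directed_set D r \<and> s \<in> D \<rightarrow> X \<and> forward_cauchy h D r s \<longrightarrow>
        (\<exists>a. bilimit X h D r s a))"


section \<open>The fuzzy numbers form an enriched category\<close>

lemma t_norm_zero_right:
  assumes "t_norm T" "a \<in> {0..1}"
  shows "T a 0 \<le> 0"
proof -
  have "mono_on {0..1} (T 0)" "T a 0 = T 0 a" "T 0 1 = 0"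
    using assms unfolding t_norm_def by (meson atLeastAtMost_iff order_refl zero_le_one)+
  then show ?thesis using mono_onD[of "{0..1}" "T 0" a 1] assms by auto
qed

lemma residuum_bounds:
  assumes "t_norm T" "a \<in> {0..1}" "b \<in> {0..1}"
  shows "residuum T a b \<in> {0..1}"
proof -
  let ?W = "{w \<in> {0..1}. T a w \<le> b}"
  have "0 \<in> ?W" using t_norm_zero_right[of T a] assms by auto
  moreover have "bdd_above ?W" by (rule bdd_aboveI[of _ 1]) auto
  ultimately have "0 \<le> Sup ?W" "Sup ?W \<le> 1"
    by (auto intro: cSup_upper cSup_least)
  then show ?thesis by (simp add: residuum_def)
qed

lemma residuum_greatest:
  assumes "t_norm T" "w \<in> {0..1}" "T a w \<le> b"
  shows "w \<le> residuum T a b"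
  unfolding residuum_def
  by (rule cSup_upper) (use assms in \<open>auto intro: bdd_aboveI[of _ 1]\<close>)

lemma residuum_attained:
  assumes "continuous_t_norm T" "a \<in> {0..1}" "b \<in> {0..1}"
  shows "T a (residuum T a b) \<le> b"
proof -
  let ?W = "{w \<in> {0..1}. T a w \<le> b}"
  have T: "t_norm T" and c: "continuous_on ({0..1} \<times> {0..1}) (\<lambda>(a, b). T a b)"
    using assms by (auto simp: continuous_t_norm_def)
  have "continuous_on {0..1} ((\<lambda>(a, b). T a b) \<circ> (\<lambda>w. (a, w)))"
    by (intro continuous_on_compose continuous_intros continuous_on_subset[OF c])
      (use assms in auto)
  then have "continuous_on {0..1} (T a)" by (simp add: o_def)
  then have "closed ({0..1} \<inter> T a -` {..b})"
    by (intro continuous_closed_preimage) auto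
  moreover have "?W = {0..1} \<inter> T a -` {..b}" by auto
  ultimately have "closed ?W" by simp
  moreover have "0 \<in> ?W" using t_norm_zero_right[OF T] assms by force
  then have "?W \<noteq> {}" by blast
  moreover have "bdd_above ?W" by (rule bdd_aboveI[of _ 1]) auto
  ultimately have "Sup ?W \<in> ?W" by (intro closed_contains_Sup)
  then show ?thesis by (simp add: residuum_def)
qed

lemma residuum_refl:
  assumes "t_norm T" "a \<in> {0..1}"
  shows "residuum T a a = 1"
proof -
  have "T a 1 = a" using assms unfolding t_norm_def by blast
  then show ?thesis
    using residuum_greatest[of T 1 a a] residuum_bounds[of T a a] assms by auto
qed

lemma t_norm_mono:
  assumes "t_norm T" "a \<in> {0..1}" "b \<in> {0..1}" "a' \<in> {0..1}" "b' \<in> {0..1}" "a \<le> a'" "b \<le> b'"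
  shows "T a b \<le> T a' b'"
proof -
  have "mono_on {0..1} (\<lambda>x. T x b)" "mono_on {0..1} (T a')"
    using assms unfolding t_norm_def by blast+
  then have "T a b \<le> T a' b" "T a' b \<le> T a' b'"
    using assms mono_onD[of "{0..1}" "\<lambda>x. T x b" a a'] mono_onD[of "{0..1}" "T a'" b b'] by auto
  then show ?thesis by simp
qed

lemma residuum_trans:
  assumes T: "continuous_t_norm T" and a: "a \<in> {0..1}" and b: "b \<in> {0..1}" and c: "c \<in> {0..1}"
    and p: "p \<in> {0..1}" "p \<le> residuum T a b" and q: "q \<in> {0..1}" "q \<le> residuum T b c"
  shows "T q p \<le> residuum T a c"
proof (rule residuum_greatest)
  show t: "t_norm T" using T by (simp add: continuous_t_norm_def)
  have cl: "\<And>x y. x \<in> {0..1} \<Longrightarrow> y \<in> {0..1} \<Longrightarrow> T x y \<in> {0..1}"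
    and comm: "\<And>x y. x \<in> {0..1} \<Longrightarrow> y \<in> {0..1} \<Longrightarrow> T x y = T y x"
    and assoc: "\<And>x y z. x \<in> {0..1} \<Longrightarrow> y \<in> {0..1} \<Longrightarrow> z \<in> {0..1} \<Longrightarrow> T (T x y) z = T x (T y z)"
    using t unfolding t_norm_def by blast+
  show "T q p \<in> {0..1}" using cl p q by blast
  have "T a p \<le> T a (residuum T a b)"
    by (rule t_norm_mono[OF t]) (use a p residuum_bounds[OF t a b] in auto)
  also have "\<dots> \<le> b" by (rule residuum_attained[OF T a b])
  finally have 1: "T a p \<le> b" .
  have "T a (T q p) = T (T a p) q"
    using comm[OF p(1) q(1)] assoc[OF a p(1) q(1)] by simp
  also have "\<dots> \<le> T b (residuum T b c)"
    by (rule t_norm_mono[OF t]) (use 1 a b p q cl residuum_bounds[OF t b c] in auto)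
  also have "\<dots> \<le> c" by (rule residuum_attained[OF T b c])
  finally show "T a (T q p) \<le> c" .
qed

lemma left_part_bounds: "u \<in> fuzzy_numbers \<Longrightarrow> left_part u x \<in> {0..1}"
  and right_part_bounds: "u \<in> fuzzy_numbers \<Longrightarrow> right_part u x \<in> {0..1}"
  by (auto simp: left_part_def right_part_def fuzzy_numbers_def)

lemma fuzzy_order_le:
  assumes T: "t_norm T" and u: "u \<in> fuzzy_numbers" and v: "v \<in> fuzzy_numbers"
  shows "fuzzy_order T u v \<le> residuum T (left_part v x) (left_part u x)"
    and "fuzzy_order T u v \<le> residuum T (right_part u x) (right_part v x)"
    and "fuzzy_order T u v \<in> {0..1}"
proof -
  let ?f = "\<lambda>x. min (residuum T (left_part v x) (left_part u x))
                     (residuum T (right_part u x) (right_part v x))"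
  have b: "?f y \<in> {0..1}" for y
    using residuum_bounds[OF T left_part_bounds[OF v] left_part_bounds[OF u], of y y]
      residuum_bounds[OF T right_part_bounds[OF u] right_part_bounds[OF v], of y y] by auto
  then have "bdd_below (range ?f)" by (intro bdd_belowI[of _ 0]) (auto simp del: min_le_iff_disj)
  then have le: "fuzzy_order T u v \<le> ?f y" for y
    unfolding fuzzy_order_def by (rule cINF_lower) simp
  show "fuzzy_order T u v \<le> residuum T (left_part v x) (left_part u x)"
    "fuzzy_order T u v \<le> residuum T (right_part u x) (right_part v x)"
    using le[of x] by auto
  have "0 \<le> fuzzy_order T u v"
    unfolding fuzzy_order_def by (rule cINF_greatest) (use b in auto)
  then show "fuzzy_order T u v \<in> {0..1}" using le[of 0] b[of 0] by auto
qed

lemma fuzzy_order_trans: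
  assumes T: "continuous_t_norm T"
    and u: "u \<in> fuzzy_numbers" and v: "v \<in> fuzzy_numbers" and w: "w \<in> fuzzy_numbers"
  shows "T (fuzzy_order T v w) (fuzzy_order T u v) \<le> fuzzy_order T u w"
proof -
  have t: "t_norm T" using T by (simp add: continuous_t_norm_def)
  let ?p = "fuzzy_order T u v" and ?q = "fuzzy_order T v w"
  note uv = fuzzy_order_le[OF t u v] and vw = fuzzy_order_le[OF t v w]
  have comm: "T ?q ?p = T ?p ?q" using uv(3) vw(3) t unfolding t_norm_def by blast
  show ?thesis
    unfolding fuzzy_order_def[of T u w]
  proof (rule cINF_greatest)
    fix x
    have "T ?p ?q \<le> residuum T (left_part w x) (left_part u x)"
      by (rule residuum_trans[OF T left_part_bounds[OF w] left_part_bounds[OF v]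
            left_part_bounds[OF u] vw(3) vw(1) uv(3) uv(1)])
    moreover have "T ?q ?p \<le> residuum T (right_part u x) (right_part w x)"
      by (rule residuum_trans[OF T right_part_bounds[OF u] right_part_bounds[OF v]
            right_part_bounds[OF w] uv(3) uv(2) vw(3) vw(2)])
    ultimately show "T ?q ?p \<le> min (residuum T (left_part w x) (left_part u x))
        (residuum T (right_part u x) (right_part w x))"
      using comm by simp
  qed simp
qed

lemma enriched_category_fuzzy_numbers:
  assumes T: "continuous_t_norm T"
  shows "enriched_category T fuzzy_numbers (sym_order T)"
  unfolding enriched_category_def
proof (intro conjI ballI)
  have t: "t_norm T" using T by (simp add: continuous_t_norm_def)
  note bd = fuzzy_order_le(3)[OF t]
  show S: "sym_order T u v \<in> {0..1}" if "u \<in> fuzzy_numbers" "v \<in> fuzzy_numbers" for u v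
    using bd[OF that] bd[OF that(2,1)] by (auto simp: sym_order_def)
  show "sym_order T u u = 1" if "u \<in> fuzzy_numbers" for u
    using residuum_refl[OF t left_part_bounds[OF that]]
      residuum_refl[OF t right_part_bounds[OF that]]
    by (simp add: sym_order_def fuzzy_order_def)
  fix u v w assume u: "u \<in> fuzzy_numbers" and v: "v \<in> fuzzy_numbers" and w: "w \<in> fuzzy_numbers"
  have comm: "T (sym_order T v w) (sym_order T u v) = T (sym_order T u v) (sym_order T v w)"
    using S[OF v w] S[OF u v] t unfolding t_norm_def by blast
  have "T (sym_order T v w) (sym_order T u v) \<le> T (fuzzy_order T v w) (fuzzy_order T u v)"
    by (rule t_norm_mono[OF t S[OF v w] S[OF u v] bd[OF v w] bd[OF u v]])
      (auto simp: sym_order_def)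
  also have "\<dots> \<le> fuzzy_order T u w" by (rule fuzzy_order_trans[OF T u v w])
  finally have 1: "T (sym_order T v w) (sym_order T u v) \<le> fuzzy_order T u w" .
  have "T (sym_order T u v) (sym_order T v w) \<le> T (fuzzy_order T v u) (fuzzy_order T w v)"
    by (rule t_norm_mono[OF t S[OF u v] S[OF v w] bd[OF v u] bd[OF w v]])
      (auto simp: sym_order_def)
  also have "\<dots> \<le> fuzzy_order T w u" by (rule fuzzy_order_trans[OF T w v u])
  finally show "T (sym_order T v w) (sym_order T u v) \<le> sym_order T u w"
    using 1 comm by (simp add: sym_order_def[of T u w])
qed

end

theory Submission
  imports Defs
begin

text \<open>
  Everything hinges on one property of the t-norm \<open>T\<close>: whether every factor \<open>c < 1\<close> annihilates
  some positive number.

  If some \<open>c < 1\<close> annihilates none, then two fuzzy numbers whose similarity is at least \<open>c\<close> have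
  left parts, and right parts, that are positive at the same points.
  The members of a Cauchy sequence then eventually share one compact support. By uniform continuity
  of \<open>T\<close> their left and right parts converge uniformly, and the limits are the parts of a fuzzy
  number: monotonicity, upper semicontinuity and the bound on the support survive, and by
  compactness so does a point with value \<open>1\<close>. If on the other hand every \<open>c < 1\<close> annihilates some
  positive number, then functions that differ only where both are small are close to each other.
  The truncations of \<open>1 / (1 + x)\<close> are then a Cauchy sequence whose only possible limit has
  unbounded support. Since the category is symmetric, completeness for nets amounts to completeness
  for sequences. Together this is \<open>smyth_complete_fuzzy_numbers_iff\<close>.

  It remains to see that the t-norms in which every \<open>c < 1\<close> annihilates some positive number are
  exactly the copies of the Lukasiewicz t-norm (\<open>isomorphic_to_lukasiewicz_iff\<close>). In such a
  t-norm the only idempotents are \<open>0\<close> and \<open>1\<close>, so that multiplication by a factor below \<open>1\<close>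
  strictly decreases every positive number. The powers of the largest \<open>2^k\<close>-th roots of \<open>0\<close> then
  form a dense copy of the dyadic numbers of the unit interval with truncated addition, and
  completing it yields the additive generator \<open>generator\<close>, whose complement to \<open>1\<close> is the
  isomorphism.
\<close>


section \<open>Continuous t-norms near the unit\<close>

locale continuous_tnorm =
  fixes T :: "real \<Rightarrow> real \<Rightarrow> real"
  assumes ct: "continuous_t_norm T"
begin

lemma tn: "t_norm T"
  using ct by (simp add: continuous_t_norm_def)

lemma closed [simp]: "a \<in> {0..1} \<Longrightarrow> b \<in> {0..1} \<Longrightarrow> T a b \<in> {0..1}"
  and commute: "a \<in> {0..1} \<Longrightarrow> b \<in> {0..1} \<Longrightarrow> T a b = T b a"
  and assoc: "a \<in> {0..1} \<Longrightarrow> b \<in> {0..1} \<Longrightarrow> c \<in> {0..1} \<Longrightarrow> T (T a b) c = T a (T b c)"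
  and one_right [simp]: "a \<in> {0..1} \<Longrightarrow> T a 1 = a"
  using tn unfolding t_norm_def by blast+

lemma one_left [simp]: "a \<in> {0..1} \<Longrightarrow> T 1 a = a"
  using commute[of 1 a] by simp

lemma zero_right [simp]: "a \<in> {0..1} \<Longrightarrow> T a 0 = 0"
  using t_norm_zero_right[OF tn, of a] closed[of a 0] by auto

lemmas mono = t_norm_mono[OF tn]

lemma le_left: "a \<in> {0..1} \<Longrightarrow> b \<in> {0..1} \<Longrightarrow> T a b \<le> a"
  using mono[of a b a 1] by auto

lemma continuous_on_tnorm:
  assumes "continuous_on S f" "continuous_on S g" "f ` S \<subseteq> {0..1}" "g ` S \<subseteq> {0..1}"
  shows "continuous_on S (\<lambda>x. T (f x) (g x))"
proof -
  have "continuous_on S ((\<lambda>(a, b). T a b) \<circ> (\<lambda>x. (f x, g x)))"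
    using assms ct unfolding continuous_t_norm_def
    by (intro continuous_on_compose continuous_on_Pair) (auto elim!: continuous_on_subset)
  then show ?thesis by (simp add: o_def)
qed

lemma continuous_on_left: "b \<in> {0..1} \<Longrightarrow> continuous_on {0..1} (\<lambda>a. T a b)"
  and continuous_on_right: "b \<in> {0..1} \<Longrightarrow> continuous_on {0..1} (T b)"
  and continuous_on_square: "continuous_on {0..1} (\<lambda>a. T a a)"
  using continuous_on_tnorm[of "{0..1}" "\<lambda>a. a" "\<lambda>_. b"]
    continuous_on_tnorm[of "{0..1}" "\<lambda>_. b" "\<lambda>a. a"]
    continuous_on_tnorm[of "{0..1}" "\<lambda>a. a" "\<lambda>a. a"]
  by (auto simp: image_subset_iff)

text \<open>The error made by a factor close to \<open>1\<close> is uniformly small in the other argument. This is what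
  turns enriched closeness into uniform closeness of real functions.\<close>

lemma near_one:
  assumes "e > 0"
  obtains w where "w \<in> {0..<1}" "\<And>v a. v \<in> {w..1} \<Longrightarrow> a \<in> {0..1} \<Longrightarrow> a - e \<le> T a v"
proof -
  have "uniformly_continuous_on ({0..1} \<times> {0..1}) (\<lambda>(a, b). T a b)"
    using ct unfolding continuous_t_norm_def
    by (intro compact_uniformly_continuous compact_Times) auto
  then obtain d where d: "d > 0" "\<And>p q. p \<in> {0..1} \<times> {0..1} \<Longrightarrow> q \<in> {0..1} \<times> {0..1} \<Longrightarrow>
      dist q p < d \<Longrightarrow> dist (case q of (a, b) \<Rightarrow> T a b) (case p of (a, b) \<Rightarrow> T a b) < e"
    using assms unfolding uniformly_continuous_on_def by metis
  show thesis
  proof (rule that[of "max 0 (1 - d/2)"])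
    show "max 0 (1 - d/2) \<in> {0..<1}" using d(1) by auto
    fix v a :: real assume v: "v \<in> {max 0 (1 - d/2)..1}" and a: "a \<in> {0..1}"
    have "dist (a, v) (a, 1) < d" using v d(1) by (auto simp: dist_Pair_Pair dist_real_def)
    then have "dist (T a v) (T a 1) < e" using d(2)[of "(a,1)" "(a,v)"] a v by auto
    then show "a - e \<le> T a v" using a by (auto simp: dist_real_def)
  qed
qed

lemma le_if_all_below_one:
  assumes "a \<in> {0..1}" "\<And>w. w \<in> {0..<1} \<Longrightarrow> T a w \<le> b"
  shows "a \<le> b"
proof (rule field_le_epsilon)
  fix e :: real assume "e > 0"
  then obtain w where "w \<in> {0..<1}" "a - e \<le> T a w" using near_one[of e] assms(1)
    by (metis atLeastAtMost_iff atLeastLessThan_iff less_eq_real_def)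
  then show "a \<le> b + e" using assms(2)[of w] by auto
qed

lemma square_near_one:
  assumes "w < 1"
  obtains v where "v \<in> {0..<1}" "w \<le> T v v"
proof -
  obtain v where v: "v \<in> {0..<1}" "\<And>v' a. v' \<in> {v..1} \<Longrightarrow> a \<in> {0..1} \<Longrightarrow> a - (1 - w)/2 \<le> T a v'"
    using near_one[of "(1 - w)/2"] assms by auto
  define u where "u = max v (max 0 (1 - (1 - w)/2))"
  have u: "u \<in> {0..<1}" "v \<le> u" "1 - (1 - w)/2 \<le> u" using v(1) assms by (auto simp: u_def)
  then have "u - (1 - w)/2 \<le> T u u" using v(2)[of u u] by auto
  then have "w \<le> T u u" using u(3) by argo
  with u(1) show thesis by (rule that)
qed

lemma le_residuum_iff:
  assumes "a \<in> {0..1}" "b \<in> {0..1}" "w \<in> {0..1}"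
  shows "w \<le> residuum T a b \<longleftrightarrow> T a w \<le> b"
  using residuum_greatest[OF tn, of w a b] residuum_attained[OF ct, of a b]
    mono[of a w a "residuum T a b"] residuum_bounds[OF tn, of a b] assms by force

end


section \<open>Smyth completeness under symmetry\<close>

definition enriched_Cauchy :: "('a \<Rightarrow> 'a \<Rightarrow> real) \<Rightarrow> (nat \<Rightarrow> 'a) \<Rightarrow> bool" where
  "enriched_Cauchy h s \<longleftrightarrow> (\<forall>w<1. \<exists>N. \<forall>n\<ge>N. \<forall>m\<ge>N. w \<le> h (s n) (s m))"

definition enriched_lim :: "('a \<Rightarrow> 'a \<Rightarrow> real) \<Rightarrow> (nat \<Rightarrow> 'a) \<Rightarrow> 'a \<Rightarrow> bool" where
  "enriched_lim h s a \<longleftrightarrow> (\<forall>w<1. \<exists>N. \<forall>n\<ge>N. w \<le> h (s n) a)"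

lemma le_SUP_INF:
  fixes f :: "'b \<Rightarrow> real"
  assumes "\<And>i. i \<in> D \<Longrightarrow> A i \<noteq> {}" "\<And>i j. i \<in> D \<Longrightarrow> j \<in> A i \<Longrightarrow> f j \<in> {0..1}"
    and "i \<in> D" "\<And>j. j \<in> A i \<Longrightarrow> v \<le> f j"
  shows "v \<le> (SUP i\<in>D. INF j\<in>A i. f j)"
proof (rule cSUP_upper2)
  show "v \<le> (INF j\<in>A i. f j)" by (rule cINF_greatest) (use assms in auto)
  have "(INF j\<in>A i. f j) \<le> 1" if i: "i \<in> D" for i
  proof -
    obtain j where "j \<in> A i" using assms(1)[OF i] by auto
    then show ?thesis
      using assms(2)[OF i] by (intro cINF_lower2[of _ _ j] bdd_belowI[of _ 0]) auto
  qed
  then show "bdd_above ((\<lambda>i. INF j\<in>A i. f j) ` D)" by (intro bdd_aboveI[of _ 1]) auto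
qed fact

lemma less_SUP_INF:
  fixes f :: "'b \<Rightarrow> real"
  assumes "D \<noteq> {}" "\<And>i j. i \<in> D \<Longrightarrow> j \<in> A i \<Longrightarrow> f j \<in> {0..1}"
    and "v < (SUP i\<in>D. INF j\<in>A i. f j)"
  shows "\<exists>i\<in>D. \<forall>j\<in>A i. v \<le> f j"
proof -
  have "\<exists>i\<in>D. v < (INF j\<in>A i. f j)"
    using assms(1,3) by (meson cSUP_least linorder_not_less)
  then obtain i where i: "i \<in> D" "v < (INF j\<in>A i. f j)" by blast
  have "(INF j\<in>A i. f j) \<le> f j" if "j \<in> A i" for j
    using that assms(2)[OF i(1)] by (intro cINF_lower bdd_belowI[of _ 0]) auto
  then show ?thesis using i by force
qed

lemma SUP_INF_eq_1_iff:
  fixes f :: "'b \<Rightarrow> real"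
  assumes "D \<noteq> {}" "\<And>i. i \<in> D \<Longrightarrow> A i \<noteq> {}" "\<And>i j. i \<in> D \<Longrightarrow> j \<in> A i \<Longrightarrow> f j \<in> {0..1}"
  shows "(SUP i\<in>D. INF j\<in>A i. f j) = 1 \<longleftrightarrow> (\<forall>w<1. \<exists>i\<in>D. \<forall>j\<in>A i. w \<le> f j)"
    (is "?S = 1 \<longleftrightarrow> ?R")
proof
  assume "?S = 1"
  show ?R
  proof (intro allI impI)
    fix w :: real assume "w < 1"
    then show "\<exists>i\<in>D. \<forall>j\<in>A i. w \<le> f j"
      using \<open>?S = 1\<close> by (intro less_SUP_INF) (use assms in auto)
  qed
next
  assume ?R
  have "w \<le> ?S" if w: "w < 1" for w
  proof -
    obtain i where "i \<in> D" "\<forall>j\<in>A i. w \<le> f j" using \<open>?R\<close> w by blast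
    then show ?thesis by (intro le_SUP_INF[of D A f i]) (use assms in auto)
  qed
  then have "1 \<le> ?S" by (rule dense_le)
  moreover have "v \<le> 1" if v: "v < ?S" for v
  proof -
    have "\<exists>i\<in>D. \<forall>j\<in>A i. v \<le> f j" by (rule less_SUP_INF[OF assms(1,3) v])
    then obtain i where i: "i \<in> D" "\<forall>j\<in>A i. v \<le> f j" by blast
    obtain j where "j \<in> A i" using assms(2)[OF i(1)] by blast
    then show ?thesis using i assms(3)[of i j] by fastforce
  qed
  then have "?S \<le> 1" by (rule dense_le)
  ultimately show "?S = 1" by simp
qed

locale symmetric_enriched = continuous_tnorm +
  fixes X :: "'a set" and h :: "'a \<Rightarrow> 'a \<Rightarrow> real"
  assumes cat: "enriched_category T X h"
    and sym: "\<And>x y. x \<in> X \<Longrightarrow> y \<in> X \<Longrightarrow> h x y = h y x"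
begin

lemma hom_range [simp]: "x \<in> X \<Longrightarrow> y \<in> X \<Longrightarrow> h x y \<in> {0..1}"
  and hom_refl [simp]: "x \<in> X \<Longrightarrow> h x x = 1"
  and hom_trans: "x \<in> X \<Longrightarrow> y \<in> X \<Longrightarrow> z \<in> X \<Longrightarrow> T (h y z) (h x y) \<le> h x z"
  using cat unfolding enriched_category_def by blast+

lemma hom_trans_le:
  assumes "x \<in> X" "y \<in> X" "z \<in> X" "v \<in> {0..1}" "w \<in> {0..1}" "v \<le> h y z" "w \<le> h x y"
  shows "T v w \<le> h x z"
  using mono[OF assms(4,5) hom_range[OF assms(2,3)] hom_range[OF assms(1,2)] assms(6,7)]
    hom_trans[OF assms(1-3)] by linarith

lemma forward_cauchy_iff:
  assumes "directed_set D r" "s \<in> D \<rightarrow> X"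
  shows "forward_cauchy h D r s \<longleftrightarrow>
    (\<forall>w<1. \<exists>i\<in>D. \<forall>j k. (i, j) \<in> r \<longrightarrow> (j, k) \<in> r \<longrightarrow> w \<le> h (s j) (s k))"
proof -
  let ?A = "\<lambda>i. {(j, k). (i, j) \<in> r \<and> (j, k) \<in> r}"
  let ?f = "\<lambda>(j, k). h (s j) (s k)"
  let ?S = "SUP i\<in>D. INF p\<in>?A i. ?f p"
  have r: "r \<subseteq> D \<times> D" "refl_on D r" "D \<noteq> {}"
    using assms(1) unfolding directed_set_def preorder_on_def by auto
  have A: "?A i \<noteq> {}" if "i \<in> D" for i using r(2) that by (auto simp: refl_on_def)
  have f: "?f p \<in> {0..1}" if p: "i \<in> D" "p \<in> ?A i" for i p
  proof -
    obtain j k where "p = (j, k)" "j \<in> D" "k \<in> D" using p(2) r(1) by auto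
    then show ?thesis using assms(2) hom_range[of "s j" "s k"] by fastforce
  qed
  have "?S = 1 \<longleftrightarrow> (\<forall>w<1. \<exists>i\<in>D. \<forall>p\<in>?A i. w \<le> ?f p)"
    by (rule SUP_INF_eq_1_iff[OF r(3) A f])
  also have "\<dots> \<longleftrightarrow> (\<forall>w<1. \<exists>i\<in>D. \<forall>j k. (i, j) \<in> r \<longrightarrow> (j, k) \<in> r \<longrightarrow> w \<le> h (s j) (s k))"
    by (simp add: split_paired_all) blast
  finally show ?thesis unfolding forward_cauchy_def .
qed

text \<open>By symmetry a net converges to \<open>a\<close> in both directions at once, and then the triangle
  inequality, used with a factor close to \<open>1\<close>, squeezes both limits in the definition of a
  bilimit. Conversely \<open>h a a = 1\<close> is one of the limits.\<close>

lemma bilimit_iff: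
  assumes "directed_set D r" "s \<in> D \<rightarrow> X"
  shows "bilimit X h D r s a \<longleftrightarrow>
    a \<in> X \<and> (\<forall>w<1. \<exists>i\<in>D. \<forall>j. (i, j) \<in> r \<longrightarrow> w \<le> h (s j) a)"
proof -
  let ?A = "\<lambda>i. {j. (i, j) \<in> r}"
  have r: "r \<subseteq> D \<times> D" "refl_on D r" "D \<noteq> {}" "trans r"
    and dir: "\<And>i j. i \<in> D \<Longrightarrow> j \<in> D \<Longrightarrow> \<exists>k\<in>D. (i, k) \<in> r \<and> (j, k) \<in> r"
    using assms(1) unfolding directed_set_def preorder_on_def by auto
  have A: "?A i \<noteq> {}" if "i \<in> D" for i using r(2) that by (auto simp: refl_on_def)
  have sX: "s j \<in> X" if "j \<in> ?A i" for i j using that r(1) assms(2) by auto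
  have f: "h x (s j) \<in> {0..1}" if "i \<in> D" "j \<in> ?A i" "x \<in> X" for i j x
    using hom_range[OF that(3) sX[OF that(2)]] .
  have swap: "(SUP i\<in>D. INF j\<in>?A i. h (s j) x) = (SUP i\<in>D. INF j\<in>?A i. h x (s j))" if "x \<in> X" for x
    using sX sym[OF that] by (intro SUP_cong INF_cong refl) auto
  show ?thesis
  proof (intro iffI conjI allI impI)
    assume b: "bilimit X h D r s a"
    then show a: "a \<in> X" by (simp add: bilimit_def)
    fix w :: real assume "w < 1"
    moreover have "(SUP i\<in>D. INF j\<in>?A i. h a (s j)) = 1"
      using b a by (simp add: bilimit_def)
    moreover have "(SUP i\<in>D. INF j\<in>?A i. h a (s j)) = 1 \<longleftrightarrow>
        (\<forall>w<1. \<exists>i\<in>D. \<forall>j\<in>?A i. w \<le> h a (s j))"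
      by (rule SUP_INF_eq_1_iff[OF r(3) A f[OF _ _ a]])
    ultimately obtain i where "i \<in> D" "\<forall>j\<in>?A i. w \<le> h a (s j)" by auto
    then show "\<exists>i\<in>D. \<forall>j. (i, j) \<in> r \<longrightarrow> w \<le> h (s j) a"
      using sX sym[OF a] by (intro bexI[of _ i]) auto
  next
    assume *: "a \<in> X \<and> (\<forall>w<1. \<exists>i\<in>D. \<forall>j. (i, j) \<in> r \<longrightarrow> w \<le> h (s j) a)"
    then have a: "a \<in> X" by blast
    have "(SUP i\<in>D. INF j\<in>?A i. h x (s j)) = h x a" (is "?S = _") if x: "x \<in> X" for x
    proof (rule antisym)
      have "v \<le> h x a" if v: "v < ?S" for v
      proof (cases "v \<le> 0")
        case True
        then show ?thesis using hom_range[OF x a] by auto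
      next
        case False
        have "\<exists>i\<in>D. \<forall>j\<in>?A i. v \<le> h x (s j)"
          by (rule less_SUP_INF[OF r(3) f[OF _ _ x] v])
        then obtain i where i: "i \<in> D" "\<And>j. j \<in> ?A i \<Longrightarrow> v \<le> h x (s j)" by blast
        have "(i, i) \<in> r" using i(1) r(2) by (auto simp: refl_on_def)
        then have v1: "v \<in> {0..1}" using i f[of i i x] x False by fastforce
        show ?thesis
        proof (rule le_if_all_below_one[OF v1])
          fix w :: real assume w: "w \<in> {0..<1}"
          then obtain i' where i': "i' \<in> D" "\<And>j. (i', j) \<in> r \<Longrightarrow> w \<le> h (s j) a"
            using * by fastforce
          obtain k where k: "(i, k) \<in> r" "(i', k) \<in> r" using dir[OF i(1) i'(1)] by blast
          then have "T w v \<le> h x a"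
            using i(2) i'(2) w v1 x a sX[of k i] by (intro hom_trans_le[of x "s k" a]) auto
          then show "T v w \<le> h x a" using commute[of v w] w v1 by auto
        qed
      qed
      then show "?S \<le> h x a" by (rule dense_le)
      show "h x a \<le> ?S"
      proof (rule le_if_all_below_one[OF hom_range[OF x a]])
        fix w :: real assume w: "w \<in> {0..<1}"
        then obtain i where i: "i \<in> D" "\<And>j. (i, j) \<in> r \<Longrightarrow> w \<le> h (s j) a"
          using * by fastforce
        have "T w (h x a) \<le> h x (s j)" if "j \<in> ?A i" for j
          using i(2)[of j] sym[OF a, of "s j"] sX[OF that] w x a that hom_range[OF x a]
          by (intro hom_trans_le[of x a "s j"]) auto
        then have "T w (h x a) \<le> ?S"
          using i(1) A f x by (intro le_SUP_INF[of D ?A _ i]) auto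
        then show "T (h x a) w \<le> ?S" using commute[of w "h x a"] w hom_range[OF x a] by auto
      qed
    qed
    then show "bilimit X h D r s a"
      unfolding bilimit_def using a swap sym[OF a] by auto
  qed
qed

text \<open>A forward Cauchy net is governed by a sequence in it: pick an index from which on the net
  is \<open>(1 - 1/(n+1))\<close>-close. Two such choices are compared through a common upper bound, which
  uses symmetry, so that these indices need not be increasing. In the other direction,
  an infinite index type contains a copy of the directed set of natural numbers.\<close>

theorem smyth_complete_iff_sequentially_complete:
  assumes "infinite (UNIV :: 'i set)"
  shows "smyth_complete TYPE('i) X h \<longleftrightarrow>
    (\<forall>s. range s \<subseteq> X \<and> enriched_Cauchy h s \<longrightarrow> (\<exists>a\<in>X. enriched_lim h s a))"
proof (intro iffI allI impI)
  fix s :: "nat \<Rightarrow> 'a"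
  assume complete: "smyth_complete TYPE('i) X h" and s: "range s \<subseteq> X \<and> enriched_Cauchy h s"
  obtain f :: "nat \<Rightarrow> 'i" where f: "inj f" using infinite_countable_subset[OF assms] by blast
  define r where "r = {(f m, f n) | m n. m \<le> n}"
  have rf: "(f m, f n) \<in> r \<longleftrightarrow> m \<le> n" for m n
    using f unfolding r_def by (auto dest: injD)
  have rf': "(f m, x) \<in> r \<longleftrightarrow> (\<exists>n\<ge>m. x = f n)" for m x
    using f unfolding r_def by (auto dest: injD)
  have "preorder_on (range f) r"
    unfolding preorder_on_def refl_on_def by (auto simp: rf) (auto simp: r_def trans_def inj_eq[OF f])
  then have D: "directed_set (range f) r"
    unfolding directed_set_def by (auto simp: rf) (meson nat_le_linear)
  let ?s = "s \<circ> inv f"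
  have sX: "?s \<in> range f \<rightarrow> X" using s by auto
  have "forward_cauchy h (range f) r ?s"
    unfolding forward_cauchy_iff[OF D sX]
  proof (intro allI impI)
    fix w :: real assume "w < 1"
    then obtain N where N: "\<And>n m. n \<ge> N \<Longrightarrow> m \<ge> N \<Longrightarrow> w \<le> h (s n) (s m)"
      using s unfolding enriched_Cauchy_def by meson
    have "w \<le> h (?s j) (?s k)" if jk: "(f N, j) \<in> r" "(j, k) \<in> r" for j k
    proof -
      obtain n where "n \<ge> N" "j = f n" using jk(1) by (auto simp: rf')
      moreover from this obtain m where "m \<ge> n" "k = f m" using jk(2) by (auto simp: rf')
      ultimately show ?thesis using N[of n m] by (simp add: inv_f_f[OF f])
    qed
    then show "\<exists>i\<in>range f. \<forall>j k. (i, j) \<in> r \<longrightarrow> (j, k) \<in> r \<longrightarrow> w \<le> h (?s j) (?s k)" by blast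
  qed
  then obtain a where "bilimit X h (range f) r ?s a"
    using complete D sX unfolding smyth_complete_def by blast
  then have "a \<in> X" and lim: "\<And>w. w < 1 \<Longrightarrow> \<exists>n. \<forall>j. (f n, j) \<in> r \<longrightarrow> w \<le> h (?s j) a"
    unfolding bilimit_iff[OF D sX] by auto
  moreover have "enriched_lim h s a"
    unfolding enriched_lim_def
  proof (intro allI impI)
    fix w :: real assume "w < 1"
    then obtain n where n: "\<And>j. (f n, j) \<in> r \<Longrightarrow> w \<le> h (?s j) a" using lim by blast
    have "w \<le> h (s m) a" if "n \<le> m" for m
      using n[of "f m"] that by (simp add: rf inv_f_f[OF f])
    then show "\<exists>N. \<forall>n\<ge>N. w \<le> h (s n) a" by blast
  qed
  ultimately show "\<exists>a\<in>X. enriched_lim h s a" by blast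
next
  assume complete: "\<forall>s. range s \<subseteq> X \<and> enriched_Cauchy h s \<longrightarrow> (\<exists>a\<in>X. enriched_lim h s a)"
  show "smyth_complete TYPE('i) X h"
    unfolding smyth_complete_def
  proof (intro allI impI, elim conjE)
    fix D :: "'i set" and r s
    assume D: "directed_set D r" and sX: "s \<in> D \<rightarrow> X" and "forward_cauchy h D r s"
    then have C: "\<And>w. w < 1 \<Longrightarrow> \<exists>i\<in>D. \<forall>j k. (i, j) \<in> r \<longrightarrow> (j, k) \<in> r \<longrightarrow> w \<le> h (s j) (s k)"
      using forward_cauchy_iff by blast
    have r: "r \<subseteq> D \<times> D" "refl_on D r"
      and dir: "\<And>i j. i \<in> D \<Longrightarrow> j \<in> D \<Longrightarrow> \<exists>k\<in>D. (i, k) \<in> r \<and> (j, k) \<in> r"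
      using D unfolding directed_set_def preorder_on_def by auto
    define w where "w n = 1 - 1 / (real n + 1)" for n
    have w: "w n \<in> {0..<1}" for n by (auto simp: w_def)
    have w_mono: "w m \<le> w n" if "m \<le> n" for m n using that by (auto simp: w_def frac_le)
    have w_lim: "\<exists>N. v \<le> w N" if v: "v < 1" for v
    proof -
      obtain N where "1 / (1 - v) < real N" using reals_Archimedean2 by blast
      then have "v \<le> w N" using v by (simp add: w_def field_simps)
      then show ?thesis ..
    qed
    have "\<forall>n. \<exists>i\<in>D. \<forall>j k. (i, j) \<in> r \<longrightarrow> (j, k) \<in> r \<longrightarrow> w n \<le> h (s j) (s k)"
      using C w by auto
    then obtain i where i: "\<And>n. i n \<in> D"
      "\<And>n j k. (i n, j) \<in> r \<Longrightarrow> (j, k) \<in> r \<Longrightarrow> w n \<le> h (s j) (s k)"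
      by metis
    have close: "w n \<le> h (s (i n)) (s j)" if "(i n, j) \<in> r" for n j
      using i(2)[of n "i n" j] i(1)[of n] r(2) that by (auto simp: refl_on_def)
    have X: "s j \<in> X" if "j \<in> D" for j using that sX by auto
    have "enriched_Cauchy h (s \<circ> i)"
      unfolding enriched_Cauchy_def
    proof (intro allI impI)
      fix v :: real assume "v < 1"
      then obtain u where u: "u \<in> {0..<1}" "v \<le> T u u" using square_near_one by blast
      then obtain N where N: "u \<le> w N" using w_lim by auto
      show "\<exists>N. \<forall>n\<ge>N. \<forall>m\<ge>N. v \<le> h ((s \<circ> i) n) ((s \<circ> i) m)"
      proof (intro exI allI impI)
        fix n m assume nm: "N \<le> n" "N \<le> m"
        obtain k where k: "k \<in> D" "(i n, k) \<in> r" "(i m, k) \<in> r" using dir[OF i(1) i(1)] by blast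
        have "T u u \<le> h (s (i n)) (s (i m))"
          using close[OF k(2)] close[OF k(3)] N w_mono[OF nm(1)] w_mono[OF nm(2)] u(1)
            sym[OF X[OF i(1)] X[OF k(1)]]
          by (intro hom_trans_le[of _ "s k"] X i k(1)) auto
        then show "v \<le> h ((s \<circ> i) n) ((s \<circ> i) m)" using u(2) by simp
      qed
    qed
    moreover have "range (s \<circ> i) \<subseteq> X" using X i(1) by auto
    ultimately obtain a where a: "a \<in> X" and lim: "enriched_lim h (s \<circ> i) a"
      using complete by blast
    have "bilimit X h D r s a"
      unfolding bilimit_iff[OF D sX]
    proof (intro conjI a allI impI)
      fix v :: real assume "v < 1"
      then obtain u where u: "u \<in> {0..<1}" "v \<le> T u u" using square_near_one by blast
      then obtain N where N: "u \<le> w N" using w_lim by auto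
      obtain M where M: "\<And>n. n \<ge> M \<Longrightarrow> u \<le> h (s (i n)) a"
        using lim u(1) unfolding enriched_lim_def by force
      let ?n = "max N M"
      have "v \<le> h (s j) a" if j: "(i ?n, j) \<in> r" for j
      proof -
        have jD: "j \<in> D" using j r(1) by auto
        have "u \<le> h (s j) (s (i ?n))"
          using close[OF j] N w_mono[of N ?n] sym[OF X[OF jD] X[OF i(1)]] by force
        then have "T u u \<le> h (s j) a"
          using M[of ?n] u(1) by (intro hom_trans_le[of _ "s (i ?n)"] X i jD a) auto
        then show ?thesis using u(2) by simp
      qed
      then show "\<exists>i\<in>D. \<forall>j. (i, j) \<in> r \<longrightarrow> v \<le> h (s j) a" using i(1) by blast
    qed
    then show "\<exists>a. bilimit X h D r s a" ..
  qed
qed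

end


section \<open>Fuzzy numbers and their parts\<close>

text \<open>A fuzzy number is the same thing as a pair of an increasing and a decreasing branch that
  both reach \<open>1\<close> at a common point. Working with such pairs keeps infima of supports and cores
  out of all limit arguments.\<close>

definition branches :: "(real \<Rightarrow> real) \<Rightarrow> (real \<Rightarrow> real) \<Rightarrow> bool" where
  "branches l r \<longleftrightarrow> (\<forall>x. l x \<in> {0..1} \<and> r x \<in> {0..1}) \<and> mono l \<and> antimono r \<and>
     upper_semicontinuous l \<and> upper_semicontinuous r \<and>
     (\<exists>p. l p = 1 \<and> r p = 1) \<and> (\<exists>a. \<forall>x<a. l x = 0) \<and> (\<exists>b. \<forall>x>b. r x = 0)"

text \<open>By upper semicontinuity the core is closed, so it contains its infimum.\<close>

lemma fuzzy_number_core: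
  assumes "u \<in> fuzzy_numbers"
  shows "u (Inf (core1 u)) = 1" and "bdd_below (core1 u)"
    and "x < Inf (support0 u) \<Longrightarrow> u x = 0" and "x > Sup (support0 u) \<Longrightarrow> u x = 0"
    and "Inf (support0 u) \<le> Inf (core1 u)" and "Inf (core1 u) \<le> Sup (support0 u)"
    and "bdd_below (support0 u)" and "bdd_above (support0 u)"
proof -
  have rng: "u x \<in> {0..1}" for x using assms by (simp add: fuzzy_numbers_def)
  have "compact (support0 u)" using assms by (simp add: fuzzy_numbers_def)
  then show bdd: "bdd_below (support0 u)" "bdd_above (support0 u)"
    by (auto dest!: compact_imp_bounded simp: bounded_imp_bdd_below bounded_imp_bdd_above)
  have sub: "{x. u x > 0} \<subseteq> support0 u" unfolding support0_def by (rule closure_subset)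
  then have cs: "core1 u \<subseteq> support0 u" by (auto simp: core1_def)
  show bc: "bdd_below (core1 u)" using bdd(1) cs by (rule bdd_below_mono)
  have "open {x. u x < 1}" using assms by (simp add: fuzzy_numbers_def upper_semicontinuous_def)
  moreover have "core1 u = - {x. u x < 1}"
    unfolding core1_def using rng by (force simp: not_less intro: antisym)
  ultimately have "closed (core1 u)" by (simp add: closed_def)
  moreover have "core1 u \<noteq> {}" using assms by (auto simp: fuzzy_numbers_def core1_def)
  ultimately have m: "Inf (core1 u) \<in> core1 u" using bc by (intro closed_contains_Inf)
  then show "u (Inf (core1 u)) = 1" by (simp add: core1_def)
  show "Inf (support0 u) \<le> Inf (core1 u)" "Inf (core1 u) \<le> Sup (support0 u)"
    using m cs bdd by (auto intro: cInf_lower cSup_upper)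
  have "u x = 0" if "x \<notin> support0 u" for x using that sub rng[of x] by force
  then show "x < Inf (support0 u) \<Longrightarrow> u x = 0" "x > Sup (support0 u) \<Longrightarrow> u x = 0"
    using bdd by (meson cInf_lower cSup_upper not_le)+
qed

text \<open>The support only matters for the value \<open>0\<close> outside of it, which \<open>u\<close> takes there anyway.\<close>

lemma left_part_eq:
  assumes "u \<in> fuzzy_numbers"
  shows "left_part u x = (if x \<le> Inf (core1 u) then u x else 1)"
  using fuzzy_number_core[OF assms] by (auto simp: left_part_def)

lemma right_part_eq:
  assumes "u \<in> fuzzy_numbers"
  shows "right_part u x = (if x < Inf (core1 u) then 1 else u x)"
  using fuzzy_number_core[OF assms] by (auto simp: right_part_def)

lemma between_eq_convex_combination:
  fixes x y z :: real
  assumes "x \<le> y" "y \<le> z"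
  obtains t where "t \<in> {0..1}" "y = t * x + (1 - t) * z"
proof -
  have "y \<in> closed_segment x z" using assms by (simp add: closed_segment_eq_real_ivl)
  then obtain t where t: "0 \<le> t" "t \<le> 1" "y = (1 - t) * x + t * z"
    by (auto simp: in_segment)
  then show thesis by (intro that[of "1 - t"]) auto
qed

lemma fuzzy_number_between:
  assumes "u \<in> fuzzy_numbers" "x \<le> y" "y \<le> z"
  shows "min (u x) (u z) \<le> u y"
proof -
  obtain t where "t \<in> {0..1}" "y = t * x + (1 - t) * z"
    using between_eq_convex_combination[OF assms(2,3)] .
  then show ?thesis using assms(1) by (auto simp: fuzzy_numbers_def simp del: min_le_iff_disj)
qed

lemma branches_parts:
  assumes u: "u \<in> fuzzy_numbers"
  shows "branches (left_part u) (right_part u)"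
proof -
  let ?m = "Inf (core1 u)"
  note core = fuzzy_number_core[OF u]
  have rng: "0 \<le> u x" "u x \<le> 1" for x using u by (auto simp: fuzzy_numbers_def)
  have op: "open {x. u x < c}" for c
    using u by (simp add: fuzzy_numbers_def upper_semicontinuous_def)
  have "mono (left_part u)"
  proof (rule monoI)
    fix x y :: real assume "x \<le> y"
    then show "left_part u x \<le> left_part u y"
      using fuzzy_number_between[OF u, of x y ?m] core(1) rng[of x]
      by (auto simp: left_part_eq[OF u])
  qed
  moreover have "antimono (right_part u)"
  proof (rule antimonoI)
    fix x y :: real assume "x \<le> y"
    then show "right_part u y \<le> right_part u x"
      using fuzzy_number_between[OF u, of ?m x y] core(1) rng[of y]
      by (auto simp: right_part_eq[OF u])
  qed
  moreover have "upper_semicontinuous (left_part u)"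
    unfolding upper_semicontinuous_def
  proof
    fix c
    show "open {x. left_part u x < c}"
    proof (cases "c \<le> 1")
      case True
      then have "{x. left_part u x < c} = {x. u x < c} \<inter> {..<?m}"
        using core(1) by (auto simp: left_part_eq[OF u] less_le split: if_splits)
      then show ?thesis by (simp add: op open_Int)
    next
      case False
      then have "left_part u x < c" for x using left_part_bounds[OF u, of x] by auto
      then have "{x. left_part u x < c} = UNIV" by blast
      then show ?thesis by simp
    qed
  qed
  moreover have "upper_semicontinuous (right_part u)"
    unfolding upper_semicontinuous_def
  proof
    fix c
    show "open {x. right_part u x < c}"
    proof (cases "c \<le> 1")
      case True
      then have "{x. right_part u x < c} = {x. u x < c} \<inter> {?m<..}"
        using core(1) by (auto simp: right_part_eq[OF u] not_less less_le split: if_splits)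
      then show ?thesis by (simp add: op open_Int)
    next
      case False
      then have "right_part u x < c" for x using right_part_bounds[OF u, of x] by auto
      then have "{x. right_part u x < c} = UNIV" by blast
      then show ?thesis by simp
    qed
  qed
  moreover have "left_part u ?m = 1 \<and> right_part u ?m = 1"
    using core(1) by (simp add: left_part_eq[OF u] right_part_eq[OF u])
  moreover have "\<forall>x<Inf (support0 u). left_part u x = 0" "\<forall>x>Sup (support0 u). right_part u x = 0"
    using core(6) by (auto simp: left_part_def right_part_def)
  ultimately show ?thesis
    unfolding branches_def using left_part_bounds[OF u] right_part_bounds[OF u]
    by (intro conjI) blast+
qed

text \<open>At the infimum of the core both branches are \<open>1\<close>, so by monotonicity the minimum agrees with
  the increasing branch up to this point and with the decreasing one from there on.\<close>

lemma fuzzy_number_of_branches: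
  assumes "branches l r"
  defines "u \<equiv> \<lambda>x. min (l x) (r x)"
  shows "u \<in> fuzzy_numbers" and "left_part u = l" and "right_part u = r"
proof -
  obtain p a b where p: "l p = 1" "r p = 1" and a: "\<And>x. x < a \<Longrightarrow> l x = 0"
    and b: "\<And>x. x > b \<Longrightarrow> r x = 0"
    using assms(1) by (auto simp: branches_def)
  have l: "mono l" and r: "antimono r" and rng: "0 \<le> l x" "l x \<le> 1" "0 \<le> r x" "r x \<le> 1"
    and usc: "open {x. l x < c}" "open {x. r x < c}" for x c
    using assms(1) by (auto simp: branches_def upper_semicontinuous_def)
  have "min (u x) (u y) \<le> u (t * x + (1 - t) * y)" if t: "t \<in> {0..1}" for x y t
  proof -
    let ?z = "t * x + (1 - t) * y"
    have "?z \<in> closed_segment x y" using t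
      by (auto simp: in_segment intro!: exI[of _ "1 - t"])
    then have "min x y \<le> ?z" "?z \<le> max x y"
      by (auto simp: closed_segment_eq_real_ivl split: if_splits)
    then have "l (min x y) \<le> l ?z" "r (max x y) \<le> r ?z"
      using monoD[OF l] antimonoD[OF r] by auto
    then show ?thesis unfolding u_def by (auto simp: min_def max_def split: if_splits)
  qed
  moreover have "upper_semicontinuous u"
    unfolding upper_semicontinuous_def
  proof
    fix c
    have "{x. u x < c} = {x. l x < c} \<union> {x. r x < c}" by (auto simp: u_def min_less_iff_disj)
    then show "open {x. u x < c}" using usc by auto
  qed
  moreover have "compact (support0 u)"
  proof -
    have "{x. u x > 0} \<subseteq> {a..b}"
    proof
      fix x assume "x \<in> {x. u x > 0}"
      then show "x \<in> {a..b}" using a[of x] b[of x]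
        by (cases "x < a"; cases "b < x") (auto simp: u_def)
    qed
    then show ?thesis unfolding support0_def
      by (meson bounded_closed_interval bounded_subset compact_closure)
  qed
  ultimately show u: "u \<in> fuzzy_numbers"
    unfolding fuzzy_numbers_def using rng p
    by (auto simp: u_def simp del: min_le_iff_disj intro!: exI[of _ p] intro: min.coboundedI1)
  let ?m = "Inf (core1 u)"
  have "min (l ?m) (r ?m) = 1" using fuzzy_number_core(1)[OF u] by (simp add: u_def)
  then have m: "l ?m = 1" "r ?m = 1" using rng(2,4)[of ?m] by (auto simp: min_def split: if_splits)
  have r1: "r x = 1" if "x \<le> ?m" for x
    using antimonoD[OF r that] rng(4)[of x] m by simp
  have l1: "l x = 1" if "x \<ge> ?m" for x
    using monoD[OF l that] rng(2)[of x] m by simp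
  show "left_part u = l"
  proof
    fix x show "left_part u x = l x"
      using r1[of x] l1[of x] rng(2)[of x] unfolding left_part_eq[OF u] by (auto simp: u_def)
  qed
  show "right_part u = r"
  proof
    fix x show "right_part u x = r x"
      using r1[of x] l1[of x] rng(4)[of x] unfolding right_part_eq[OF u] by (auto simp: u_def)
  qed
qed

text \<open>The adjunction between \<open>T\<close> and its residuum removes both the residua and the infimum.\<close>

lemma (in continuous_tnorm) le_sym_order_iff:
  assumes u: "u \<in> fuzzy_numbers" and v: "v \<in> fuzzy_numbers" and w: "w \<in> {0..1}"
  shows "w \<le> sym_order T u v \<longleftrightarrow>
    (\<forall>x. T (left_part u x) w \<le> left_part v x \<and> T (left_part v x) w \<le> left_part u x \<and>
         T (right_part u x) w \<le> right_part v x \<and> T (right_part v x) w \<le> right_part u x)"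
proof -
  have order: "w \<le> fuzzy_order T u v \<longleftrightarrow>
      (\<forall>x. T (left_part v x) w \<le> left_part u x \<and> T (right_part u x) w \<le> right_part v x)"
    if u: "u \<in> fuzzy_numbers" and v: "v \<in> fuzzy_numbers" for u v
  proof -
    have "w \<le> fuzzy_order T u v \<longleftrightarrow>
      (\<forall>x. w \<le> residuum T (left_part v x) (left_part u x) \<and>
           w \<le> residuum T (right_part u x) (right_part v x))"
      (is "_ \<longleftrightarrow> ?R")
    proof
      assume "w \<le> fuzzy_order T u v"
      then show ?R using fuzzy_order_le(1,2)[OF tn u v] by (meson order_trans)
    next
      assume ?R
      then show "w \<le> fuzzy_order T u v"
        unfolding fuzzy_order_def by (intro cINF_greatest) auto
    qed
    then show ?thesis
      using le_residuum_iff[OF left_part_bounds[OF v] left_part_bounds[OF u] w]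
        le_residuum_iff[OF right_part_bounds[OF u] right_part_bounds[OF v] w] by simp
  qed
  show ?thesis unfolding sym_order_def using order[OF u v] order[OF v u] by auto
qed

text \<open>As for continuity, one good approximation \<open>f n\<close> transfers its open sublevel sets, up to an
  error that half of the gap \<open>c - g x\<close> absorbs.\<close>

lemma upper_semicontinuous_uniform_limit:
  assumes lim: "uniform_limit UNIV f g sequentially" and f: "\<And>n::nat. upper_semicontinuous (f n)"
  shows "upper_semicontinuous g"
  unfolding upper_semicontinuous_def
proof
  fix c
  show "open {x. g x < c}"
  proof (rule openI)
    fix x assume x: "x \<in> {x. g x < c}"
    define d where "d = (c - g x) / 2"
    have d: "d > 0" "g x + d + d = c" using x by (auto simp: d_def)
    obtain n where "\<forall>y\<in>UNIV. dist (f n y) (g y) < d"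
      using eventually_happens[OF uniform_limitD[OF lim d(1)]] by auto
    then have n: "\<bar>f n y - g y\<bar> < d" for y by (simp add: dist_real_def)
    have "open {y. f n y < g x + d}" using f by (simp add: upper_semicontinuous_def)
    moreover have "x \<in> {y. f n y < g x + d}" using n[of x] by auto
    ultimately obtain e where e: "e > 0" "ball x e \<subseteq> {y. f n y < g x + d}"
      by (meson openE)
    have "ball x e \<subseteq> {y. g y < c}"
    proof
      fix y assume "y \<in> ball x e"
      then have "f n y < g x + d" using e(2) by auto
      then show "y \<in> {y. g y < c}" using n[of y] d(2) by auto
    qed
    then show "\<exists>e>0. ball x e \<subseteq> {x. g x < c}" using e(1) by blast
  qed
qed

text \<open>A point where both branches of the limit are \<open>1\<close> is found as an accumulation point of peaks of
  the approximating fuzzy numbers. Upper semicontinuity keeps the value \<open>1\<close> at that point,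
  and the common bound \<open>{a..b}\<close> ensures that it exists.\<close>

lemma branches_uniform_limit:
  assumes br: "\<And>n::nat. branches (f n) (g n)"
    and f: "uniform_limit UNIV f l sequentially" and g: "uniform_limit UNIV g r sequentially"
    and a: "\<And>n x. n \<ge> N \<Longrightarrow> x < a \<Longrightarrow> f n x = 0" and b: "\<And>n x. n \<ge> N \<Longrightarrow> x > b \<Longrightarrow> g n x = 0"
  shows "branches l r"
proof -
  have fl: "(\<lambda>n. f n x) \<longlonglongrightarrow> l x" and gr: "(\<lambda>n. g n x) \<longlonglongrightarrow> r x" for x
    using tendsto_uniform_limitI[OF f, of x] tendsto_uniform_limitI[OF g, of x] by auto
  have rng: "0 \<le> f n x" "f n x \<le> 1" "0 \<le> g n x" "g n x \<le> 1"
    and mn: "mono (f n)" "antimono (g n)"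
    and usc: "upper_semicontinuous (f n)" "upper_semicontinuous (g n)" for n x
    using br[of n] by (auto simp: branches_def)
  have l01: "0 \<le> l x" "l x \<le> 1" and r01: "0 \<le> r x" "r x \<le> 1" for x
    using LIMSEQ_le_const[OF fl, of 0 x] LIMSEQ_le_const2[OF fl, of x 1]
      LIMSEQ_le_const[OF gr, of 0 x] LIMSEQ_le_const2[OF gr, of x 1] rng by simp_all
  have l: "mono l"
    by (rule monoI, rule LIMSEQ_le[OF fl fl]) (simp add: monoD[OF mn(1)])
  have r: "antimono r"
    by (rule antimonoI, rule LIMSEQ_le[OF gr gr]) (simp add: antimonoD[OF mn(2)])
  have uscl: "upper_semicontinuous l" and uscr: "upper_semicontinuous r"
    using upper_semicontinuous_uniform_limit f g usc by blast+
  have la: "l x = 0" if "x < a" for x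
  proof (rule LIMSEQ_unique[OF fl])
    have "eventually (\<lambda>n. 0 = f n x) sequentially"
      using a that by (auto simp: eventually_sequentially intro!: exI[of _ N])
    then show "(\<lambda>n. f n x) \<longlonglongrightarrow> 0" by (rule Lim_transform_eventually[rotated]) simp
  qed
  have rb: "r x = 0" if "x > b" for x
  proof (rule LIMSEQ_unique[OF gr])
    have "eventually (\<lambda>n. 0 = g n x) sequentially"
      using b that by (auto simp: eventually_sequentially intro!: exI[of _ N])
    then show "(\<lambda>n. g n x) \<longlonglongrightarrow> 0" by (rule Lim_transform_eventually[rotated]) simp
  qed
  obtain p where p: "\<And>n. f n (p n) = 1" "\<And>n. g n (p n) = 1"
    using br unfolding branches_def by metis
  have "p (n + N) \<in> {a..b}" for n
    using a[of "n + N" "p (n + N)"] b[of "n + N" "p (n + N)"] p[of "n + N"]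
    by (cases "p (n + N) < a"; cases "b < p (n + N)") auto
  then obtain q \<sigma> where "strict_mono \<sigma>" "((\<lambda>n. p (n + N)) \<circ> \<sigma>) \<longlonglongrightarrow> q"
    using seq_compactE[OF compact_imp_seq_compact[OF compact_Icc[of a b]], of "\<lambda>n. p (n + N)"]
    by blast
  then have q: "strict_mono \<sigma>" "(\<lambda>n. p (\<sigma> n + N)) \<longlonglongrightarrow> q" by (simp_all add: o_def)
  have peak: "k q = 1" if lim: "uniform_limit UNIV h k sequentially" and "upper_semicontinuous k"
    and "\<And>x. k x \<le> 1" and h: "\<And>n. h n (p n) = 1" for h :: "nat \<Rightarrow> real \<Rightarrow> real" and k
  proof (rule ccontr)
    assume "k q \<noteq> 1"
    then have lt: "k q < 1" using that(3)[of q] by simp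
    then obtain c where c: "k q < c" "c < 1" using dense by blast
    then have "open {x. k x < c}" "q \<in> {x. k x < c}"
      using that(2) by (auto simp: upper_semicontinuous_def)
    then have 1: "eventually (\<lambda>n. p (\<sigma> n + N) \<in> {x. k x < c}) sequentially"
      by (rule topological_tendstoD[OF q(2)])
    have "filterlim (\<lambda>n. \<sigma> n + N) at_top sequentially"
      by (rule filterlim_at_top_mono[OF filterlim_subseq[OF q(1)]]) simp
    moreover have "eventually (\<lambda>n. \<forall>x\<in>UNIV. dist (h n x) (k x) < 1 - c) sequentially"
      using c(2) by (intro uniform_limitD[OF lim]) simp
    ultimately have 2: "eventually (\<lambda>n. \<forall>x\<in>UNIV. dist (h (\<sigma> n + N) x) (k x) < 1 - c) sequentially"
      by (rule eventually_compose_filterlim[rotated])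
    obtain n where "k (p (\<sigma> n + N)) < c"
      "\<bar>h (\<sigma> n + N) (p (\<sigma> n + N)) - k (p (\<sigma> n + N))\<bar> < 1 - c"
      using eventually_happens[OF eventually_conj[OF 1 2]] by (auto simp: dist_real_def)
    then show False using h[of "\<sigma> n + N"] by simp
  qed
  show ?thesis
    unfolding branches_def using l01 r01 l r uscl uscr la rb peak[OF f uscl] peak[OF g uscr] p
    by auto
qed


section \<open>When Cauchy sequences of fuzzy numbers converge\<close>

context continuous_tnorm
begin

text \<open>By \<open>near_one\<close> the hypothesis bounds the uniform distance between late members of the sequence.\<close>

lemma uniform_limit_of_Cauchy:
  fixes f :: "nat \<Rightarrow> 'b \<Rightarrow> real"
  assumes rng: "\<And>n x. f n x \<in> {0..1}"
    and Cauchy: "\<And>w. w \<in> {0..<1} \<Longrightarrow> \<exists>N. \<forall>n\<ge>N. \<forall>m\<ge>N. \<forall>x. T (f n x) w \<le> f m x"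
  obtains l where "uniform_limit UNIV f l sequentially"
proof -
  have "uniformly_Cauchy_on UNIV f"
    unfolding uniformly_Cauchy_on_def
  proof (intro allI impI)
    fix e :: real assume "e > 0"
    then obtain w where w: "w \<in> {0..<1}"
      "\<And>v a. v \<in> {w..1} \<Longrightarrow> a \<in> {0..1} \<Longrightarrow> a - e/2 \<le> T a v"
      using near_one[of "e/2"] by auto
    obtain N where N: "\<forall>n\<ge>N. \<forall>m\<ge>N. \<forall>x. T (f n x) w \<le> f m x"
      using Cauchy[OF w(1)] by blast
    have le: "f n x - e/2 \<le> f m x" if "n \<ge> N" "m \<ge> N" for n m x
    proof -
      have "f n x - e/2 \<le> T (f n x) w" using w(1) rng by (intro w(2)) auto
      then show ?thesis using N that by (meson order_trans)
    qed
    have "dist (f m x) (f n x) < e" if "m \<ge> N" "n \<ge> N" for m n x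
      using le[OF that, of x] le[OF that(2,1), of x] \<open>e > 0\<close> by (simp add: dist_real_def)
    then show "\<exists>M. \<forall>x\<in>UNIV. \<forall>m\<ge>M. \<forall>n\<ge>M. dist (f m x) (f n x) < e" by blast
  qed
  then show thesis
    using Cauchy_uniformly_convergent that unfolding uniformly_convergent_on_def by blast
qed

text \<open>Closeness in the sense of \<open>T\<close> is a closed condition, so it passes to the limit in either
  argument.\<close>

lemma limit_bounds:
  assumes rng: "\<And>n. f n \<in> {0..1}" and lim: "f \<longlonglongrightarrow> l" and w: "w \<in> {0..1}"
    and close: "\<And>n m. n \<ge> N \<Longrightarrow> m \<ge> N \<Longrightarrow> T (f n) w \<le> f m" and n: "n \<ge> N"
  shows "T (f n) w \<le> l" and "T l w \<le> f n"
proof -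
  show "T (f n) w \<le> l" using lim close n by (intro LIMSEQ_le_const[OF lim]) blast
  have l: "l \<in> {0..1}"
    using closed_sequentially[OF closed_atLeastAtMost, of f 0 1 l] rng lim by auto
  have "(\<lambda>m. T (f m) w) \<longlonglongrightarrow> T l w"
    using continuous_on_tendsto_compose[OF continuous_on_left[OF w] lim l] rng by simp
  then show "T l w \<le> f n"
    using close n by (intro LIMSEQ_le_const2[of _ "T l w"]) blast+
qed

text \<open>Once two members of a Cauchy sequence have similarity at least \<open>c\<close>, positivity of a part of one
  at a point forces positivity of the same part of the other, so the supports are
  eventually constant. This is exactly what keeps the support of the uniform limit bounded.\<close>

lemma fuzzy_numbers_sequentially_complete:
  assumes c: "c \<in> {0..<1}" "\<And>a. a \<in> {0<..1} \<Longrightarrow> T a c > 0"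
    and s: "\<And>n. s n \<in> fuzzy_numbers" and Cauchy: "enriched_Cauchy (sym_order T) s"
  shows "\<exists>u\<in>fuzzy_numbers. enriched_lim (sym_order T) s u"
proof -
  let ?f = "\<lambda>n. left_part (s n)" and ?g = "\<lambda>n. right_part (s n)"
  note f01 = left_part_bounds[OF s] and g01 = right_part_bounds[OF s]
  have close: "\<exists>N. \<forall>n\<ge>N. \<forall>m\<ge>N. \<forall>x. T (?f n x) w \<le> ?f m x \<and> T (?g n x) w \<le> ?g m x"
    if w: "w \<in> {0..<1}" for w
  proof -
    obtain N where "\<forall>n\<ge>N. \<forall>m\<ge>N. w \<le> sym_order T (s n) (s m)"
      using Cauchy w unfolding enriched_Cauchy_def by auto
    moreover have "w \<in> {0..1}" using w by auto
    ultimately show ?thesis using le_sym_order_iff[OF s s] by (intro exI[of _ N]) blast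
  qed
  obtain l where l: "uniform_limit UNIV ?f l sequentially"
    by (rule uniform_limit_of_Cauchy[of ?f, OF f01]) (use close in meson)
  obtain r where r: "uniform_limit UNIV ?g r sequentially"
    by (rule uniform_limit_of_Cauchy[of ?g, OF g01]) (use close in meson)
  obtain N where N: "\<And>n m x. n \<ge> N \<Longrightarrow> m \<ge> N \<Longrightarrow> T (?f n x) c \<le> ?f m x"
    "\<And>n m x. n \<ge> N \<Longrightarrow> m \<ge> N \<Longrightarrow> T (?g n x) c \<le> ?g m x"
    using close[OF c(1)] by blast
  have zero: "a = 0" if "a \<in> {0..1}" "T a c \<le> 0" for a
    using c(2)[of a] that by force
  obtain a b where ab: "\<And>x. x < a \<Longrightarrow> ?f N x = 0" "\<And>x. x > b \<Longrightarrow> ?g N x = 0"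
    using branches_parts[OF s, of N] unfolding branches_def by blast
  have fa: "?f n x = 0" if "n \<ge> N" "x < a" for n x
    using zero[OF f01] N(1)[OF that(1) order_refl, of x] ab(1)[OF that(2)] by simp
  have gb: "?g n x = 0" if "n \<ge> N" "x > b" for n x
    using zero[OF g01] N(2)[OF that(1) order_refl, of x] ab(2)[OF that(2)] by simp
  have "branches l r"
    by (rule branches_uniform_limit[OF branches_parts[OF s] l r fa gb])
  note u = fuzzy_number_of_branches[OF this]
  have fl: "(\<lambda>n. ?f n x) \<longlonglongrightarrow> l x" and gr: "(\<lambda>n. ?g n x) \<longlonglongrightarrow> r x" for x
    using tendsto_uniform_limitI[OF l, of x] tendsto_uniform_limitI[OF r, of x] by auto
  have "\<exists>N. \<forall>n\<ge>N. w \<le> sym_order T (s n) (\<lambda>x. min (l x) (r x))" if "w < 1" for w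
  proof -
    let ?w = "max 0 w"
    have w: "?w \<in> {0..<1}" "?w \<in> {0..1}" using that by auto
    obtain N where N: "\<forall>n\<ge>N. \<forall>m\<ge>N. \<forall>x. T (?f n x) ?w \<le> ?f m x \<and> T (?g n x) ?w \<le> ?g m x"
      using close[OF w(1)] by blast
    have "?w \<le> sym_order T (s n) (\<lambda>x. min (l x) (r x))" if n: "n \<ge> N" for n
      unfolding le_sym_order_iff[OF s u(1) w(2)] u(2,3)
      using limit_bounds[OF f01 fl w(2) _ n] limit_bounds[OF g01 gr w(2) _ n] N by simp
    then show ?thesis by auto
  qed
  then show ?thesis unfolding enriched_lim_def using u(1) by blast
qed

text \<open>If small values are invisible next to factors close to \<open>1\<close>, then the truncations of
  \<open>1 / (1 + x)\<close> at \<open>n\<close> form a Cauchy sequence, because any two of them differ only where both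
  are small. Its limit would have to be positive on the whole half-line.\<close>

lemma fuzzy_numbers_not_sequentially_complete:
  assumes nil: "\<And>c. c \<in> {0..<1} \<Longrightarrow> \<exists>a\<in>{0<..1}. T a c = 0"
  obtains s where "range s \<subseteq> fuzzy_numbers" "enriched_Cauchy (sym_order T) s"
    "\<And>u. u \<in> fuzzy_numbers \<Longrightarrow> \<not> enriched_lim (sym_order T) s u"
proof -
  define l :: "real \<Rightarrow> real" where "l x = (if x < 0 then 0 else 1)" for x
  define r :: "nat \<Rightarrow> real \<Rightarrow> real"
    where "r n x = (if x \<le> 0 then 1 else if x \<le> real n then 1 / (1 + x) else 0)" for n x
  have r01: "r n x \<in> {0..1}" for n x by (auto simp: r_def)
  have "branches l (r n)" for n
    unfolding branches_def
  proof (intro conjI)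
    show "mono l" by (auto simp: l_def intro: monoI)
    show r: "antimono (r n)" by (auto simp: r_def frac_le intro!: antimonoI)
    show "upper_semicontinuous l"
      unfolding upper_semicontinuous_def
    proof
      fix c :: real
      have "{x. l x < c} = (if c > 1 then UNIV else if c > 0 then {..<0} else {})"
        by (auto simp: l_def)
      then show "open {x. l x < c}" by simp
    qed
    show "upper_semicontinuous (r n)"
      unfolding upper_semicontinuous_def
    proof
      fix c :: real
      show "open {x. r n x < c}"
      proof (cases "c > 0")
        case False
        then have "{x. r n x < c} = {}" using r01[of n] by (auto intro: order_trans simp: not_less)
        then show ?thesis by simp
      next
        case c: True
        show ?thesis
        proof (cases "c > 1")
          case True
          then have "{x. r n x < c} = UNIV" using r01[of n] by (auto intro: le_less_trans)
          then show ?thesis by simp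
        next
          case False
          have "r n x < c \<longleftrightarrow> real n < x \<or> 1 / c - 1 < x" for x
          proof (cases "x > 0")
            case True
            then have "1 / (1 + x) < c \<longleftrightarrow> 1 / c - 1 < x" using c by (simp add: field_simps)
            then show ?thesis using True c by (simp add: r_def)
          next
            case nonpos: False
            have "1 \<le> 1 / c" using c False by simp
            then show ?thesis using nonpos False by (simp add: r_def)
          qed
          then have "{x. r n x < c} = {real n<..} \<union> {1 / c - 1<..}" by auto
          then show ?thesis by auto
        qed
      qed
    qed
    show "\<exists>p. l p = 1 \<and> r n p = 1" by (rule exI[of _ 0]) (simp add: l_def r_def)
    show "\<exists>a. \<forall>x<a. l x = 0" by (rule exI[of _ 0]) (simp add: l_def)
    show "\<exists>b. \<forall>x>b. r n x = 0" by (rule exI[of _ "real n"]) (simp add: r_def)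
    show "\<forall>x. l x \<in> {0..1} \<and> r n x \<in> {0..1}" using r01 by (auto simp: l_def)
  qed
  note s = fuzzy_number_of_branches[OF this]
  let ?s = "\<lambda>n x. min (l x) (r n x)"
  show thesis
  proof (rule that[of ?s])
    show "range ?s \<subseteq> fuzzy_numbers" using s(1) by blast
    show "enriched_Cauchy (sym_order T) ?s"
      unfolding enriched_Cauchy_def
    proof (intro allI impI)
      fix w :: real assume "w < 1"
      let ?w = "max 0 w"
      have w: "?w \<in> {0..<1}" "?w \<in> {0..1}" using \<open>w < 1\<close> by auto
      obtain a where a: "a \<in> {0<..1}" "T a ?w = 0" using nil[OF w(1)] by blast
      obtain N where N: "1 / a < real N" using reals_Archimedean2 by blast
      have "T (r n x) ?w \<le> r m x" if "n \<ge> N" "m \<ge> N" for n m x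
      proof (cases "x \<le> real N")
        case True
        then have "r n x = r m x" using that by (simp add: r_def)
        then show ?thesis using le_left[OF r01 w(2), of n x] by simp
      next
        case False
        then have "1 / a < 1 + x" "0 < x" using N a(1) by (auto intro: le_less_trans[of 0])
        then have "1 / (1 + x) \<le> a" using a(1) by (simp add: field_simps)
        then have "r n x \<le> a" using \<open>0 < x\<close> a(1) by (simp add: r_def)
        then have "T (r n x) ?w \<le> T a ?w"
          using a(1) w(2) r01 by (intro mono) auto
        then show ?thesis using a(2) r01[of m x] by auto
      qed
      moreover have "T (l x) ?w \<le> l x" for x
        using w(2) by (intro le_left) (auto simp: l_def)
      ultimately have "?w \<le> sym_order T (?s n) (?s m)" if "n \<ge> N" "m \<ge> N" for n m
        unfolding le_sym_order_iff[OF s(1) s(1) w(2)] s(2,3) using that by blast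
      then show "\<exists>N. \<forall>n\<ge>N. \<forall>m\<ge>N. w \<le> sym_order T (?s n) (?s m)" by auto
    qed
    fix u assume u: "u \<in> fuzzy_numbers"
    show "\<not> enriched_lim (sym_order T) ?s u"
    proof
      assume lim: "enriched_lim (sym_order T) ?s u"
      obtain b where b: "\<And>x. x > b \<Longrightarrow> right_part u x = 0"
        using branches_parts[OF u] unfolding branches_def by blast
      define x where "x = max 0 b + 1"
      have x: "x > 0" "right_part u x = 0" using b by (auto simp: x_def)
      have "1 / (1 + x) \<le> 0"
      proof (rule le_if_all_below_one)
        show "1 / (1 + x) \<in> {0..1}" using x by auto
        fix w :: real assume w: "w \<in> {0..<1}"
        then obtain N where N: "\<And>n. n \<ge> N \<Longrightarrow> w \<le> sym_order T (?s n) u"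
          using lim unfolding enriched_lim_def by fastforce
        obtain M where "x < real M" using reals_Archimedean2 by blast
        let ?n = "max N M"
        have w1: "w \<in> {0..1}" using w by auto
        have "T (r ?n x) w \<le> right_part u x"
          using N[of ?n] unfolding le_sym_order_iff[OF s(1) u w1] s(3) by simp
        moreover have "x \<le> real ?n" using \<open>x < real M\<close> by linarith
        then have "r ?n x = 1 / (1 + x)" using x(1) by (simp add: r_def)
        ultimately show "T (1 / (1 + x)) w \<le> 0" using x(2) by simp
      qed
      then show False using x(1) by (simp add: divide_le_0_iff)
    qed
  qed
qed

lemma symmetric_enriched_fuzzy_numbers:
  "symmetric_enriched T fuzzy_numbers (sym_order T)"
  by unfold_locales (auto simp: enriched_category_fuzzy_numbers[OF ct] sym_order_def min.commute)

theorem smyth_complete_fuzzy_numbers_iff: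
  assumes "infinite (UNIV :: 'i set)"
  shows "smyth_complete TYPE('i) fuzzy_numbers (sym_order T) \<longleftrightarrow>
    (\<exists>c\<in>{0..<1}. \<forall>a\<in>{0<..1}. T a c \<noteq> 0)"
proof -
  interpret symmetric_enriched T fuzzy_numbers "sym_order T"
    by (rule symmetric_enriched_fuzzy_numbers)
  have pos: "T a c > 0" if "c \<in> {0..<1}" "a \<in> {0<..1}" "T a c \<noteq> 0" for a c
    using closed[of a c] that by auto
  show ?thesis
    unfolding smyth_complete_iff_sequentially_complete[OF assms]
  proof
    assume complete: "\<forall>s. range s \<subseteq> fuzzy_numbers \<and> enriched_Cauchy (sym_order T) s \<longrightarrow>
      (\<exists>a\<in>fuzzy_numbers. enriched_lim (sym_order T) s a)"
    show "\<exists>c\<in>{0..<1}. \<forall>a\<in>{0<..1}. T a c \<noteq> 0"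
    proof (rule ccontr)
      assume "\<not> ?thesis"
      then have nil: "\<And>c. c \<in> {0..<1} \<Longrightarrow> \<exists>a\<in>{0<..1}. T a c = 0" by blast
      show False
        by (rule fuzzy_numbers_not_sequentially_complete[OF nil]) (use complete in blast)+
    qed
  next
    assume "\<exists>c\<in>{0..<1}. \<forall>a\<in>{0<..1}. T a c \<noteq> 0"
    then obtain c where "c \<in> {0..<1}" "\<And>a. a \<in> {0<..1} \<Longrightarrow> T a c > 0" using pos by blast
    then show "\<forall>s. range s \<subseteq> fuzzy_numbers \<and> enriched_Cauchy (sym_order T) s \<longrightarrow>
      (\<exists>a\<in>fuzzy_numbers. enriched_lim (sym_order T) s a)"
      using fuzzy_numbers_sequentially_complete by (metis range_subsetD)
  qed
qed

end


section \<open>Characterization of the Lukasiewicz t-norm\<close>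

context continuous_tnorm
begin

primrec tpow :: "real \<Rightarrow> nat \<Rightarrow> real" where
  "tpow x 0 = 1"
| "tpow x (Suc n) = T x (tpow x n)"

lemma tpow_range: "x \<in> {0..1} \<Longrightarrow> tpow x n \<in> {0..1}"
proof (induction n)
  case (Suc n)
  then show ?case using closed[of x "tpow x n"] by (simp del: atLeastAtMost_iff)
qed simp

lemma tpow_of_one: "tpow 1 n = 1"
  by (induction n) auto

lemma tpow_add: "x \<in> {0..1} \<Longrightarrow> tpow x (m + n) = T (tpow x m) (tpow x n)"
proof (induction m)
  case 0
  then show ?case using tpow_range[of x n] by simp
next
  case (Suc m)
  then show ?case using assoc[OF Suc.prems tpow_range[OF Suc.prems] tpow_range[OF Suc.prems]] by simp
qed

lemma tpow_mult: "x \<in> {0..1} \<Longrightarrow> tpow x (m * n) = tpow (tpow x m) n"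
  by (induction n) (simp_all add: tpow_add)

lemma tpow_antimono:
  assumes x: "x \<in> {0..1}" and "m \<le> n"
  shows "tpow x n \<le> tpow x m"
proof -
  obtain k where "n = m + k" using \<open>m \<le> n\<close> le_Suc_ex by blast
  then show ?thesis using tpow_add[OF x, of m k] le_left[OF tpow_range[OF x] tpow_range[OF x]] by simp
qed

lemma continuous_on_tpow: "continuous_on {0..1} (\<lambda>x. tpow x n)"
proof (induction n)
  case (Suc n)
  have "continuous_on {0..1} (\<lambda>x. T x (tpow x n))"
    using Suc tpow_range by (intro continuous_on_tnorm continuous_intros) blast+
  then show ?case by simp
qed simp

end

text \<open>The condition says that the negation \<open>a \<mapsto> residuum T a 0\<close> tends to \<open>1\<close> at \<open>0\<close>.\<close>

locale nilpotent_tnorm = continuous_tnorm +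
  assumes annihilated: "\<And>c. c \<in> {0..<1} \<Longrightarrow> \<exists>a\<in>{0<..1}. T a c = 0"
begin

text \<open>An idempotent \<open>e\<close> acts as a unit on everything below it, since each \<open>a \<le> e\<close> is a multiple
  of \<open>e\<close> by continuity. A positive idempotent thus annihilates no positive number.\<close>

lemma idempotent:
  assumes e: "e \<in> {0..<1}" "T e e = e"
  shows "e = 0"
proof (rule ccontr)
  assume "e \<noteq> 0"
  then have pos: "e > 0" and e1: "e \<in> {0..1}" using e(1) by auto
  obtain a where a: "a \<in> {0<..1}" "T a e = 0" using annihilated[OF e(1)] by blast
  have a1: "a \<in> {0..1}" using a(1) by auto
  show False
  proof (cases "a \<le> e")
    case True
    then have "\<exists>b\<ge>0. b \<le> 1 \<and> T e b = a"
      using a1 e1 by (intro IVT' continuous_on_right) auto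
    then obtain b where b: "b \<in> {0..1}" "T e b = a" by auto
    have "T a e = T e (T e b)" using b(2) commute[OF a1 e1] by simp
    also have "\<dots> = a" using assoc[OF e1 e1 b(1)] e(2) b(2) by simp
    finally show False using a by simp
  next
    case False
    then have "T e e \<le> T a e" using a1 e1 by (intro mono) auto
    then show False using a(2) e(2) pos by simp
  qed
qed

text \<open>The smallest factor that fixes \<open>x\<close> is idempotent.\<close>

lemma strictly_decreasing:
  assumes x: "x \<in> {0<..1}" and w: "w \<in> {0..<1}"
  shows "T x w < x"
proof (rule ccontr)
  assume "\<not> T x w < x"
  moreover have x1: "x \<in> {0..1}" and w1: "w \<in> {0..1}" using x w by auto
  ultimately have fixed: "T x w = x" using le_left[OF x1 w1] by simp
  let ?V = "{v \<in> {0..1}. T x v = x}"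
  have "closed ({0..1} \<inter> T x -` {x})"
    by (intro continuous_closed_preimage continuous_on_right x1) auto
  moreover have "?V = {0..1} \<inter> T x -` {x}" by auto
  ultimately have "closed ?V" by simp
  moreover have wV: "w \<in> ?V" using w1 fixed by simp
  moreover have bdd: "bdd_below ?V" by (rule bdd_belowI[of _ 0]) auto
  ultimately have V: "Inf ?V \<in> ?V" by (intro closed_contains_Inf) auto
  define v where "v = Inf ?V"
  have v: "v \<in> {0..1}" "T x v = x" using V unfolding v_def[symmetric] by blast+
  have vw: "v \<le> w" unfolding v_def using wV bdd by (rule cInf_lower)
  have "T x (T v v) = x" using assoc[OF x1 v(1) v(1)] v(2) by simp
  then have "T v v \<in> ?V" using closed[OF v(1) v(1)] by blast
  then have "v \<le> T v v" unfolding v_def using bdd by (rule cInf_lower)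
  then have "T v v = v" using le_left[OF v(1) v(1)] by simp
  then have "v = 0" using v(1) vw w by (intro idempotent) auto
  then show False using v(2) x1 x by simp
qed

text \<open>The largest \<open>2^k\<close>-th root of \<open>0\<close>. In the Lukasiewicz t-norm it is \<open>1 - 1/2^k\<close>, and its
  \<open>m\<close>-th power is \<open>1 - m/2^k\<close> as long as this is nonnegative.\<close>

definition zero_root :: "nat \<Rightarrow> real" where
  "zero_root k = Sup {x \<in> {0..1}. tpow x (2 ^ k) = 0}"

lemma zero_root_range: "zero_root k \<in> {0..1}"
  and tpow_zero_root_eq_0: "tpow (zero_root k) (2 ^ k) = 0"
  and le_zero_root: "x \<in> {0..1} \<Longrightarrow> tpow x (2 ^ k) = 0 \<Longrightarrow> x \<le> zero_root k"
proof -
  let ?V = "{x \<in> {0..1}. tpow x (2 ^ k) = 0}"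
  have "closed ({0..1} \<inter> (\<lambda>x. tpow x (2 ^ k)) -` {0})"
    by (intro continuous_closed_preimage continuous_on_tpow) auto
  moreover have "?V = {0..1} \<inter> (\<lambda>x. tpow x (2 ^ k)) -` {0}" by auto
  ultimately have "closed ?V" by simp
  moreover have "tpow 0 (2 ^ k) = 0"
    using tpow_antimono[of 0 1 "2 ^ k"] tpow_range[of 0 "2 ^ k"] by auto
  then have "0 \<in> ?V" by simp
  moreover have bdd: "bdd_above ?V" by (rule bdd_aboveI[of _ 1]) auto
  ultimately have V: "zero_root k \<in> ?V" unfolding zero_root_def by (metis (no_types, lifting) closed_contains_Sup empty_iff)
  then show "zero_root k \<in> {0..1}" "tpow (zero_root k) (2 ^ k) = 0" by blast+
  show "x \<in> {0..1} \<Longrightarrow> tpow x (2 ^ k) = 0 \<Longrightarrow> x \<le> zero_root k"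
    unfolding zero_root_def using bdd by (intro cSup_upper) auto
qed

lemma zero_root_less_1: "zero_root k \<in> {0..<1}"
proof -
  have "zero_root k \<noteq> 1" using tpow_zero_root_eq_0[of k] tpow_of_one[of "2 ^ k"] by force
  then show ?thesis using zero_root_range[of k] by auto
qed

text \<open>Squaring a \<open>2^(k+1)\<close>-th root of \<open>0\<close> gives a \<open>2^k\<close>-th root of \<open>0\<close>, and by continuity every
  element has a square root.\<close>

lemma zero_root_square: "T (zero_root (Suc k)) (zero_root (Suc k)) = zero_root k"
proof (rule antisym)
  let ?r = "zero_root (Suc k)"
  have sq: "tpow x (2 ^ Suc k) = tpow (T x x) (2 ^ k)" if "x \<in> {0..1}" for x
    using tpow_mult[OF that, of 2 "2 ^ k"] that by (simp add: numeral_2_eq_2)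
  show "T ?r ?r \<le> zero_root k"
    by (rule le_zero_root) (use closed[OF zero_root_range zero_root_range] sq[OF zero_root_range] tpow_zero_root_eq_0 in metis)+
  have "\<exists>y\<ge>0. y \<le> 1 \<and> T y y = zero_root k"
    using zero_root_range[of k] by (intro IVT' continuous_on_square) auto
  then obtain y where y: "y \<in> {0..1}" "T y y = zero_root k" by auto
  have "y \<le> ?r" using sq[OF y(1)] y tpow_zero_root_eq_0 by (intro le_zero_root) auto
  then show "zero_root k \<le> T ?r ?r" using mono[OF y(1) y(1) zero_root_range zero_root_range] y(2) by metis
qed

lemma tpow_zero_root: "tpow (zero_root (k + j)) (2 ^ j) = zero_root k"
proof (induction j)
  case 0
  then show ?case using zero_root_range[of k] by simp
next
  case (Suc j)
  have "tpow (zero_root (Suc (k + j))) (2 * 2 ^ j) = tpow (zero_root (k + j)) (2 ^ j)"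
    using tpow_mult[OF zero_root_range, of "Suc (k + j)" 2 "2 ^ j"] zero_root_square[of "k + j"] zero_root_range
    by (simp add: numeral_2_eq_2)
  then show ?case using Suc by simp
qed

lemma zero_root_pos: "zero_root (Suc k) > 0"
proof -
  obtain a where a: "a \<in> {0<..1}" "T a (1/2) = 0" using annihilated[of "1/2"] by auto
  define b where "b = min a (1/2)"
  have b: "b \<in> {0..1}" "b > 0" using a(1) by (auto simp: b_def)
  have "T b b \<le> T a (1/2)" using a(1) b by (intro mono) (auto simp: b_def)
  then have "tpow b 2 \<le> 0" using a(2) b(1) by (simp add: numeral_2_eq_2)
  moreover have "tpow b (2 ^ Suc k) \<le> tpow b 2" by (rule tpow_antimono[OF b(1)]) simp
  ultimately have "tpow b (2 ^ Suc k) = 0" using tpow_range[OF b(1), of "2 ^ Suc k"] by auto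
  then show ?thesis using le_zero_root[OF b(1), of "Suc k"] b(2) by simp
qed

text \<open>The roots increase, and by \<open>zero_root_square\<close> their limit is idempotent.\<close>

lemma zero_root_tendsto_1:
  assumes "v < 1"
  obtains k where "v \<le> zero_root k"
proof -
  have inc: "incseq zero_root"
    using zero_root_square le_left[OF zero_root_range zero_root_range] by (metis incseq_SucI)
  obtain l where l: "zero_root \<longlonglongrightarrow> l" "\<And>k. zero_root k \<le> l"
    using incseq_convergent[OF inc, of 1] zero_root_range by auto
  have l1: "l \<in> {0..1}"
    using closed_sequentially[OF closed_atLeastAtMost, of zero_root 0 1 l] zero_root_range l(1) by auto
  have "(\<lambda>k. zero_root (Suc k)) \<longlonglongrightarrow> l" using l(1) by (rule LIMSEQ_Suc)
  then have "(\<lambda>k. T (zero_root (Suc k)) (zero_root (Suc k))) \<longlonglongrightarrow> T l l"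
    by (rule continuous_on_tendsto_compose[OF continuous_on_square _ l1])
      (use zero_root_range in \<open>auto simp del: atLeastAtMost_iff\<close>)
  then have "zero_root \<longlonglongrightarrow> T l l" by (simp only: zero_root_square)
  then have idem: "T l l = l" using l(1) by (rule LIMSEQ_unique)
  have "l > 0" using zero_root_pos[of 0] l(2)[of "Suc 0"] by simp
  then have "l = 1" using idempotent[of l, OF _ idem] l1 by (cases "l < 1") auto
  then have "eventually (\<lambda>k. v < zero_root k) sequentially" using order_tendstoD(1)[OF l(1)] assms by simp
  then obtain k where "v < zero_root k" using eventually_happens by force
  then show thesis by (intro that[of k]) simp
qed

text \<open>Let \<open>s = zero_root (k + k)\<close>, whose \<open>2^k\<close>-th power is \<open>zero_root k\<close>. Being a smaller power
  of \<open>s\<close>, \<open>tpow s m\<close> exceeds \<open>zero_root k\<close>, so by maximality its \<open>2^k\<close>-th power is not \<open>0\<close>.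
  That power is the \<open>m\<close>-th power of \<open>zero_root k\<close>.\<close>

lemma tpow_zero_root_pos:
  assumes "m < 2 ^ k"
  shows "tpow (zero_root k) m > 0"
proof (cases k)
  case 0
  then show ?thesis using assms by simp
next
  case (Suc j)
  then have pos: "zero_root k > 0" by (simp add: zero_root_pos)
  let ?s = "zero_root (k + k)"
  have le: "zero_root k \<le> tpow ?s (Suc m)"
    using tpow_antimono[OF zero_root_range, of "Suc m" "2 ^ k" "k + k"] assms tpow_zero_root[of k k] by simp
  also have "\<dots> = T (tpow ?s m) ?s" using commute[OF zero_root_range tpow_range[OF zero_root_range]] by simp
  finally have le: "zero_root k \<le> T (tpow ?s m) ?s" .
  then have "tpow ?s m > 0" using le_left[OF tpow_range[OF zero_root_range] zero_root_range] pos
    by (meson less_le_trans)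
  then have "T (tpow ?s m) ?s < tpow ?s m"
    using tpow_range[OF zero_root_range] zero_root_less_1 by (intro strictly_decreasing) auto
  then have "zero_root k < tpow ?s m" using le by simp
  then have "tpow (tpow ?s m) (2 ^ k) \<noteq> 0"
    using le_zero_root[OF tpow_range[OF zero_root_range]] by (meson not_le)
  moreover have "tpow (tpow ?s m) (2 ^ k) = tpow (tpow ?s (2 ^ k)) m"
    by (metis tpow_mult[OF zero_root_range] mult.commute)
  ultimately show ?thesis using tpow_zero_root[of k k] tpow_range[OF zero_root_range, of k m] by auto
qed

lemma tpow_zero_root_refine: "tpow (zero_root (k + j)) (m * 2 ^ j) = tpow (zero_root k) m"
  using tpow_mult[OF zero_root_range, of "k + j" "2 ^ j" m] tpow_zero_root[of k j] by (simp add: mult.commute)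

lemma tpow_zero_root_refine': "tpow (zero_root (j + k)) (m * 2 ^ j) = tpow (zero_root k) m"
  using tpow_zero_root_refine[of k j m] by (simp add: add.commute)

text \<open>Two dyadic numbers are compared on a common denominator, where the claim concerns two powers of
  the same number. The value of the power thus depends on the dyadic number only.\<close>

lemma tpow_zero_root_antimono:
  assumes "real m / 2 ^ k \<le> real n / 2 ^ j"
  shows "tpow (zero_root j) n \<le> tpow (zero_root k) m"
proof -
  have "real (m * 2 ^ j) \<le> real (n * 2 ^ k)" using assms by (simp add: field_simps)
  then have "m * 2 ^ j \<le> n * 2 ^ k" by (simp only: of_nat_le_iff)
  then show ?thesis
    using tpow_antimono[OF zero_root_range, of _ _ "k + j"] tpow_zero_root_refine[of k j m] tpow_zero_root_refine'[of k j n]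
    by metis
qed

lemma tpow_zero_root_strict_antimono:
  assumes "real m / 2 ^ k < real n / 2 ^ j" and m: "m < 2 ^ k"
  shows "tpow (zero_root j) n < tpow (zero_root k) m"
proof -
  let ?r = "zero_root (k + j)"
  have "real (m * 2 ^ j) < real (n * 2 ^ k)" using assms by (simp add: field_simps)
  then have "Suc (m * 2 ^ j) \<le> n * 2 ^ k" by (simp only: of_nat_less_iff Suc_le_eq)
  then have "tpow ?r (n * 2 ^ k) \<le> tpow ?r (Suc (m * 2 ^ j))"
    by (rule tpow_antimono[OF zero_root_range])
  also have "\<dots> = T (tpow ?r (m * 2 ^ j)) ?r"
    using commute[OF zero_root_range tpow_range[OF zero_root_range]] by simp
  also have "\<dots> < tpow ?r (m * 2 ^ j)"
  proof (rule strictly_decreasing[OF _ zero_root_less_1])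
    have "m * 2 ^ j < 2 ^ (k + j)" using m by (simp add: power_add)
    then show "tpow ?r (m * 2 ^ j) \<in> {0<..1}"
      using tpow_zero_root_pos tpow_range[OF zero_root_range, of "k + j" "m * 2 ^ j"] by auto
  qed
  finally show ?thesis using tpow_zero_root_refine[of k j m] tpow_zero_root_refine'[of k j n] by simp
qed

text \<open>The additive generator: the inverse of \<open>m / 2^k \<mapsto> tpow (zero_root k) m\<close>, extended to all
  of the unit interval.\<close>

definition generator :: "real \<Rightarrow> real" where
  "generator x = Sup {real m / 2 ^ k | k m. m \<le> 2 ^ k \<and> x \<le> tpow (zero_root k) m}"

lemma le_generator:
  assumes "m \<le> 2 ^ k" "x \<le> tpow (zero_root k) m"
  shows "real m / 2 ^ k \<le> generator x"
  unfolding generator_def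
proof (rule cSup_upper)
  show "bdd_above {real m / 2 ^ k | k m. m \<le> 2 ^ k \<and> x \<le> tpow (zero_root k) m}"
    by (rule bdd_aboveI[of _ 1]) (auto simp: divide_le_eq)
qed (use assms in blast)

lemma generator_nonneg: "x \<in> {0..1} \<Longrightarrow> 0 \<le> generator x"
  using le_generator[of 0 0 x] by simp

lemma generator_nonempty:
  "x \<in> {0..1} \<Longrightarrow> {real m / 2 ^ k | k m. m \<le> 2 ^ k \<and> x \<le> tpow (zero_root k) m} \<noteq> {}"
  by (auto intro!: exI[of _ 0])

text \<open>With the inequality \<open>le_generator\<close> in the other direction this pins down the generator on the
  powers of the roots, and everywhere else by comparison with them.\<close>

lemma generator_le:
  assumes x: "x \<in> {0..1}" and m: "tpow (zero_root k) m \<le> x" "m \<le> 2 ^ k"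
  shows "generator x \<le> real m / 2 ^ k"
  unfolding generator_def
proof (rule cSup_least[OF generator_nonempty[OF x]])
  fix d assume "d \<in> {real m / 2 ^ k | k m. m \<le> 2 ^ k \<and> x \<le> tpow (zero_root k) m}"
  then obtain n j where d: "d = real n / 2 ^ j" "n \<le> 2 ^ j" "x \<le> tpow (zero_root j) n" by blast
  show "d \<le> real m / 2 ^ k"
  proof (rule ccontr)
    assume less: "\<not> d \<le> real m / 2 ^ k"
    moreover have "real n \<le> 2 ^ j" using d(2) by (metis of_nat_le_iff of_nat_numeral of_nat_power)
    then have "d \<le> 1" using d(1) by simp
    ultimately have "real m / 2 ^ k < 1" by linarith
    then have "real m < real (2 ^ k)" by simp
    then have "m < 2 ^ k" by (simp only: of_nat_less_iff)
    then have "tpow (zero_root j) n < tpow (zero_root k) m"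
      using less d(1) by (intro tpow_zero_root_strict_antimono) auto
    then show False using m(1) d(3) by simp
  qed
qed

lemma generator_range: "x \<in> {0..1} \<Longrightarrow> generator x \<in> {0..1}"
  using generator_nonneg[of x] generator_le[of x 0 1] tpow_zero_root_eq_0[of 0] by auto

lemma generator_zero: "x \<le> 0 \<Longrightarrow> 1 \<le> generator x"
  using le_generator[of 1 0 x] tpow_zero_root_eq_0[of 0] by simp

text \<open>For large \<open>k\<close> the consecutive powers of \<open>zero_root k\<close> are so close to each other that two of
  them lie between \<open>x\<close> and \<open>y\<close>.\<close>

lemma generator_strict_antimono:
  assumes "x \<in> {0..1}" "y \<in> {0..1}" "x < y"
  shows "generator y < generator x"
proof -
  define e where "e = (y - x) / 2"
  have e: "e > 0" "y - e - e = x" using assms(3) by (auto simp: e_def)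
  obtain w where w: "w \<in> {0..<1}" "\<And>v a. v \<in> {w..1} \<Longrightarrow> a \<in> {0..1} \<Longrightarrow> a - e \<le> T a v"
    using near_one[OF e(1)] by auto
  obtain k where k: "w \<le> zero_root k" using zero_root_tendsto_1[of w] w(1) by auto
  let ?E = "tpow (zero_root k)"
  have step: "?E m - e \<le> ?E (Suc m)" for m
    using w(2)[of "zero_root k" "?E m"] k zero_root_range[of k] tpow_range[OF zero_root_range, of k m]
      commute[OF zero_root_range tpow_range[OF zero_root_range]] by auto
  \<comment> \<open>The first power to fall below \<open>y\<close> cannot be more than \<open>e\<close> below it, and its successor not more than \<open>2 * e\<close>.\<close>
  define m where "m = (LEAST m. ?E m \<le> y)"
  have "?E (2 ^ k) \<le> y" using tpow_zero_root_eq_0[of k] assms(2) by simp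
  then have m: "?E m \<le> y" "m \<le> 2 ^ k" unfolding m_def by (rule LeastI, rule Least_le)
  have "y - e \<le> ?E m"
  proof (cases m)
    case 0
    then show ?thesis using assms(2) e(1) by simp
  next
    case (Suc n)
    then have "\<not> ?E n \<le> y" unfolding m_def by (intro not_less_Least) simp
    then show ?thesis using step[of n] Suc by simp
  qed
  then have "?E m > 0" "x \<le> ?E (Suc m)" using step[of m] e assms(1) by auto
  moreover from this have "m \<noteq> 2 ^ k" using tpow_zero_root_eq_0[of k] by auto
  ultimately have "real (Suc m) / 2 ^ k \<le> generator x" using m(2) by (intro le_generator) auto
  moreover have "generator y \<le> real m / 2 ^ k" by (rule generator_le[OF assms(2) m])
  moreover have "real m / 2 ^ k < real (Suc m) / 2 ^ k" by (simp add: divide_strict_right_mono)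
  ultimately show ?thesis by linarith
qed

lemma dyadic_between:
  assumes "0 \<le> a" "a < (b::real)"
  obtains m k where "a < real m / 2 ^ k" "real m / 2 ^ k < b"
proof -
  obtain k where k: "1 / (b - a) < 2 ^ k" using real_arch_pow[of 2 "1 / (b - a)"] by auto
  define m where "m = nat \<lfloor>a * 2 ^ k\<rfloor> + 1"
  have "real m = of_int \<lfloor>a * 2 ^ k\<rfloor> + 1" using assms by (simp add: m_def)
  then have m: "a * 2 ^ k < real m" "real m \<le> a * 2 ^ k + 1" by linarith+
  have "1 < (b - a) * 2 ^ k" using k assms by (simp add: field_simps)
  then have "real m < b * 2 ^ k" using m(2) by (simp add: algebra_simps)
  then show thesis using m(1) by (intro that[of m k]) (simp_all add: field_simps)
qed

lemma dyadic_le_1: "real m / 2 ^ k \<le> 1 \<Longrightarrow> m \<le> 2 ^ k"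
proof -
  assume "real m / 2 ^ k \<le> 1"
  then have "real m \<le> real (2 ^ k)" by simp
  then show ?thesis by (simp only: of_nat_le_iff)
qed

text \<open>The preimage is the value at \<open>r\<close> of the decreasing extension of \<open>m / 2^k \<mapsto> tpow (zero_root k) m\<close>
  to the reals.\<close>

lemma generator_surj:
  assumes r: "r \<in> {0..1}"
  obtains x where "x \<in> {0..1}" "generator x = r"
proof -
  let ?V = "{tpow (zero_root k) m | k m. m \<le> 2 ^ k \<and> r \<le> real m / 2 ^ k}"
  define x where "x = Sup ?V"
  have V01: "?V \<subseteq> {0..1}" using tpow_range[OF zero_root_range] by blast
  then have bdd: "bdd_above ?V" by (meson bdd_above_Icc bdd_above_mono)
  have "1 \<le> (2::nat) ^ 0 \<and> r \<le> real 1 / 2 ^ 0" using r by simp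
  then have ne: "?V \<noteq> {}" by blast
  have x: "x \<in> {0..1}"
  proof -
    obtain v where v: "v \<in> ?V" using ne by blast
    then have "v \<le> x" unfolding x_def using bdd by (rule cSup_upper)
    moreover have "x \<le> 1" unfolding x_def by (rule cSup_least[OF ne]) (use V01 in force)
    ultimately show ?thesis using V01 v by force
  qed
  have "generator x \<ge> r"
  proof (rule ccontr)
    assume "\<not> generator x \<ge> r"
    then obtain m k where mk: "generator x < real m / 2 ^ k" "real m / 2 ^ k < r"
      using dyadic_between[OF generator_nonneg[OF x], of r] by auto
    have "x \<le> tpow (zero_root k) m"
      unfolding x_def using mk(2) by (intro cSup_least[OF ne]) (auto intro!: tpow_zero_root_antimono)
    moreover have "m \<le> 2 ^ k" using mk(2) r[simplified] by (intro dyadic_le_1) linarith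
    ultimately show False using le_generator[of m k x] mk(1) by simp
  qed
  moreover have "generator x \<le> r"
  proof (rule ccontr)
    assume "\<not> generator x \<le> r"
    then obtain m k where mk: "r < real m / 2 ^ k" "real m / 2 ^ k < generator x"
      using dyadic_between[of r "generator x"] r by auto
    have m: "m \<le> 2 ^ k" using mk(2) generator_range[OF x, simplified] by (intro dyadic_le_1) linarith
    have "tpow (zero_root k) m \<le> x"
      unfolding x_def using mk(1) m by (intro cSup_upper[OF _ bdd]) (blast intro: less_imp_le)
    then show False using generator_le[OF x _ m] mk(2) by simp
  qed
  ultimately show thesis using that[OF x] by simp
qed

lemma tpow_zero_root_add:
  "tpow (zero_root (k + j)) (m * 2 ^ j + n * 2 ^ k) = T (tpow (zero_root k) m) (tpow (zero_root j) n)"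
  "real (m * 2 ^ j + n * 2 ^ k) / 2 ^ (k + j) = real m / 2 ^ k + real n / 2 ^ j"
  using tpow_add[OF zero_root_range] tpow_zero_root_refine[of k j m] tpow_zero_root_refine'[of k j n]
  by (simp_all add: power_add field_simps)

text \<open>On powers of the roots, multiplication adds exponents, and the powers vanish from exponent \<open>1\<close> on.
  Strict inequalities between generators leave room for dyadic exponents on which this applies.\<close>

lemma generator_tnorm:
  assumes x: "x \<in> {0..1}" and y: "y \<in> {0..1}"
  shows "generator (T x y) = min 1 (generator x + generator y)"
proof (rule antisym)
  note xy = closed[OF x y]
  have "generator (T x y) \<le> generator x + generator y"
  proof (rule ccontr)
    let ?d = "(generator (T x y) - (generator x + generator y)) / 2"
    assume "\<not> ?thesis"
    then have d: "?d > 0" by simp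
    obtain m k where m: "generator x < real m / 2 ^ k" "real m / 2 ^ k < generator x + ?d"
      using dyadic_between[OF generator_nonneg[OF x], of "generator x + ?d"] d by auto
    obtain n j where n: "generator y < real n / 2 ^ j" "real n / 2 ^ j < generator y + ?d"
      using dyadic_between[OF generator_nonneg[OF y], of "generator y + ?d"] d by auto
    have less: "real m / 2 ^ k + real n / 2 ^ j < generator (T x y)" using m(2) n(2) by argo
    have nonneg: "0 \<le> real m / 2 ^ k" "0 \<le> real n / 2 ^ j" by simp_all
    note le1 = generator_range[OF xy, simplified]
    have "m \<le> 2 ^ k" using less nonneg le1 by (intro dyadic_le_1) linarith
    then have "tpow (zero_root k) m \<le> x" using le_generator[of m k x] m(1) by force
    moreover have "n \<le> 2 ^ j" using less nonneg le1 by (intro dyadic_le_1) linarith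
    then have "tpow (zero_root j) n \<le> y" using le_generator[of n j y] n(1) by force
    ultimately have "T (tpow (zero_root k) m) (tpow (zero_root j) n) \<le> T x y"
      using x y tpow_range[OF zero_root_range] by (intro mono) auto
    then have "tpow (zero_root (k + j)) (m * 2 ^ j + n * 2 ^ k) \<le> T x y" by (simp only: tpow_zero_root_add)
    moreover have "m * 2 ^ j + n * 2 ^ k \<le> 2 ^ (k + j)"
      by (rule dyadic_le_1) (use less le1 in \<open>simp only: tpow_zero_root_add\<close>, linarith)
    ultimately have "generator (T x y) \<le> real (m * 2 ^ j + n * 2 ^ k) / 2 ^ (k + j)"
      by (rule generator_le[OF xy])
    then show False using less by (simp only: tpow_zero_root_add)
  qed
  then show "generator (T x y) \<le> min 1 (generator x + generator y)"
    using generator_range[OF xy] by simp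
  show "min 1 (generator x + generator y) \<le> generator (T x y)"
  proof (rule ccontr)
    assume "\<not> ?thesis"
    then have less: "generator (T x y) < 1" "generator (T x y) - generator y < generator x" by auto
    obtain m k where m: "m \<le> 2 ^ k" "x \<le> tpow (zero_root k) m" "generator (T x y) - generator y < real m / 2 ^ k"
      using less_cSupD[OF generator_nonempty[OF x] less(2)[unfolded generator_def[of x]]] by blast
    then have less2: "generator (T x y) - real m / 2 ^ k < generator y" by simp
    obtain n j where n: "n \<le> 2 ^ j" "y \<le> tpow (zero_root j) n" "generator (T x y) - real m / 2 ^ k < real n / 2 ^ j"
      using less_cSupD[OF generator_nonempty[OF y] less2[unfolded generator_def[of y]]] by blast
    let ?K = "k + j" and ?M = "m * 2 ^ j + n * 2 ^ k"
    have "T x y \<le> T (tpow (zero_root k) m) (tpow (zero_root j) n)"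
      using x y m(2) n(2) tpow_range[OF zero_root_range] by (intro mono) auto
    then have le: "T x y \<le> tpow (zero_root ?K) ?M" by (simp only: tpow_zero_root_add)
    show False
    proof (cases "?M \<le> 2 ^ ?K")
      case True
      then have "real ?M / 2 ^ ?K \<le> generator (T x y)" using le by (rule le_generator)
      then show False using n(3) unfolding tpow_zero_root_add by simp
    next
      case False
      then have "tpow (zero_root ?K) ?M \<le> 0"
        using tpow_antimono[OF zero_root_range, of "2 ^ ?K" ?M ?K] tpow_zero_root_eq_0[of ?K] by simp
      then show False using generator_zero[of "T x y"] le less(1) by simp
    qed
  qed
qed

lemma isomorphic_to_lukasiewicz: "isomorphic_t_norms T lukasiewicz"
  unfolding isomorphic_t_norms_def
proof (intro exI conjI ballI)
  let ?\<phi> = "\<lambda>x. 1 - generator x"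
  show strict: "strict_mono_on {0..1} ?\<phi>"
    using generator_strict_antimono by (auto intro!: strict_mono_onI)
  have "?\<phi> ` {0..1} = {0..1}"
  proof (intro equalityI subsetI)
    fix y :: real assume "y \<in> {0..1}"
    then obtain x where "x \<in> {0..1}" "generator x = 1 - y" using generator_surj[of "1 - y"] by auto
    then show "y \<in> ?\<phi> ` {0..1}" by force
  qed (use generator_range in force)
  then show "bij_betw ?\<phi> {0..1} {0..1}"
    using strict_mono_on_imp_inj_on[OF strict] by (simp add: bij_betw_def)
  fix a b :: real assume "a \<in> {0..1}" "b \<in> {0..1}"
  then show "?\<phi> (T a b) = lukasiewicz (?\<phi> a) (?\<phi> b)"
    by (simp add: generator_tnorm lukasiewicz_def)
qed

end

lemma (in continuous_tnorm) isomorphic_to_lukasiewicz_iff: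
  "isomorphic_t_norms T lukasiewicz \<longleftrightarrow> (\<forall>c\<in>{0..<1}. \<exists>a\<in>{0<..1}. T a c = 0)"
proof
  assume "isomorphic_t_norms T lukasiewicz"
  then obtain \<phi> where \<phi>: "strict_mono_on {0..1} \<phi>" "bij_betw \<phi> {0..1} {0..1}"
    and hom: "\<And>a b. a \<in> {0..1} \<Longrightarrow> b \<in> {0..1} \<Longrightarrow> \<phi> (T a b) = lukasiewicz (\<phi> a) (\<phi> b)"
    unfolding isomorphic_t_norms_def by blast
  have rng: "\<phi> x \<in> {0..1}" if "x \<in> {0..1}" for x using \<phi>(2) that by (rule bij_betw_apply)
  have surj: "\<exists>x\<in>{0..1}. \<phi> x = y" if "y \<in> {0..1}" for y
    using \<phi>(2) that by (metis bij_betw_iff_bijections)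
  have inj: "x = y" if "x \<in> {0..1}" "y \<in> {0..1}" "\<phi> x = \<phi> y" for x y
    using \<phi>(2) that by (auto simp: bij_betw_def dest: inj_onD)
  have le: "\<phi> x \<le> \<phi> y" if "x \<in> {0..1}" "y \<in> {0..1}" "x \<le> y" for x y
    using strict_mono_onD[OF \<phi>(1), of x y] that by (cases "x = y") auto
  obtain z where "z \<in> {0..1}" "\<phi> z = 0" using surj[of 0] by auto
  then have \<phi>0: "\<phi> 0 = 0" using le[of 0 z] rng[of 0] by auto
  show "\<forall>c\<in>{0..<1}. \<exists>a\<in>{0<..1}. T a c = 0"
  proof
    fix c :: real assume c: "c \<in> {0..<1}"
    then have "\<phi> c < \<phi> 1" by (intro strict_mono_onD[OF \<phi>(1)]) auto
    then have c1: "\<phi> c < 1" using rng[of 1] by auto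
    obtain a where a: "a \<in> {0..1}" "\<phi> a = 1 - \<phi> c" using surj[of "1 - \<phi> c"] rng[of c] c by auto
    then have "a \<noteq> 0" using \<phi>0 c1 by auto
    have "\<phi> (T a c) = \<phi> 0" using hom[of a c] a c \<phi>0 by (auto simp: lukasiewicz_def)
    moreover have "T a c \<in> {0..1}" using c by (intro closed a(1)) auto
    ultimately have "T a c = 0" using inj[of "T a c" 0] by simp
    with \<open>a \<noteq> 0\<close> show "\<exists>a\<in>{0<..1}. T a c = 0" using a(1) by (intro bexI[of _ a]) auto
  qed
next
  assume "\<forall>c\<in>{0..<1}. \<exists>a\<in>{0<..1}. T a c = 0"
  then interpret nilpotent_tnorm T by unfold_locales blast
  show "isomorphic_t_norms T lukasiewicz" by (rule isomorphic_to_lukasiewicz)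
qed


section \<open>Smyth completeness of the fuzzy numbers\<close>

theorem corollary4p14:
  fixes T :: "real \<Rightarrow> real \<Rightarrow> real"
  assumes "continuous_t_norm T"
    and "infinite (UNIV :: 'i set)"
  shows "smyth_complete TYPE('i) fuzzy_numbers (sym_order T) \<longleftrightarrow>
         \<not> isomorphic_t_norms T lukasiewicz"
proof -
  interpret continuous_tnorm T by unfold_locales (rule assms(1))
  show ?thesis
    unfolding smyth_complete_fuzzy_numbers_iff[OF assms(2)] isomorphic_to_lukasiewicz_iff by blast
qed

end
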